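(* Let $\mathcal{E}$ be an elementary topos with a local state classifier $\{\xi_X\colon X\to\Xi\}_{X\in\mathrm{ob}(\mathcal{E})}$, and let $\iota_F\colon F\rightarrowtail\Xi$ be an internal filter. Let $\mathcal{E}_F\hookrightarrow\mathcal{E}$ be the full subcategory of those objects $X$ for which $\xi_X$ factors through $\iota_F$, and for $Z\in\mathrm{ob}(\mathcal{E}_F)$ let $\xi^F_Z\colon Z\to F$ be the unique morphism with $\iota_F\circ\xi^F_Z=\xi_Z$. Then the family of morphisms $\{\xi^F_Z\colon Z\to F\}_{Z\in\mathrm{ob}(\mathcal{E}_F)}$ is a local state classifier of the hyperconnected quotient topos $\mathcal{E}_F$ (in particular, implicitly, $F\in\mathrm{ob}(\mathcal{E}_F)$).
   Context: Local state classifier: for a category $\mathcal{C}$, let $\mathcal{C}_{\mathrm{mono}}$ be the category with the same objects as $\mathcal{C}$ and with the monomorphisms of $\mathcal{C}$ as morphisms. A local state classifier of $\mathcal{C}$ is a (possibly large) colimit of the inclusion functor $\mathcal{C}_{\mathrm{mono}}\to\mathcal{C}$, i.e. an object $\Xi$ with a family $\{\xi_X\colon X\to\Xi\}_{X\in\mathrm{ob}(\mathcal{C})}$ such that $\xi_Y\circ m=\xi_X$ for every monomorphism $m\colon X\rightarrowtail Y$, and which is universal: for every object $L$ and family $\{\phi_X\colon X\to L\}_{X\in\mathrm{ob}(\mathcal{C})}$ with $\phi_Y\circ m=\phi_X$ for all monomorphisms $m\colon X\rightarrowtail Y$, there is a unique $u\colon\Xi\to L$ with $u\circ\xi_X=\phi_X$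 for all $X$. Order structure (known): if $\mathcal{E}$ is cartesian closed with a local state classifier $\Xi$, there is a unique internal $\wedge$-semilattice structure (with top) on $\Xi$ such that, for all objects $X_1,\dots,X_n$ ($n\ge0$), the composite of $\xi_{X_1}\times\cdots\times\xi_{X_n}\colon X_1\times\cdots\times X_n\to\Xi^n$ with the $n$-ary meet $\wedge\colon\Xi^n\to\Xi$ equals $\xi_{X_1\times\cdots\times X_n}$. Hence every hom-set $\mathcal{E}(X,\Xi)$ is a $\wedge$-semilattice with top, ordered by $f\le g\iff f\wedge g=f$. Internal filter: a subobject $\iota_F\colon F\rightarrowtail\Xi$ such that for every object $X$ the subset $\mathcal{E}(X,F)\rightarrowtail\mathcal{E}(X,\Xi)$ (via composition with $\iota_F$) is upward closed, contains the top element, and is closed under binary meets. It is known that, for an internal filter $F$ in an elementary topos $\mathcal{E}$ with local state classifier, $\mathcal{E}_F$ is an elementary topos and the inclusion $\mathcal{E}_F\hookrightarrow\mathcal{E}$ is the inverse image part of a hyperconnected geometric morphism $\mathcal{E}\to\mathcal{E}_F$ (that is, a geometric morphism $f$ with $f^*$ fully faithful and monic counit $f^*f_*\to\mathrm{id}_{\mathcal{E}}$); $\mathcal{E}_F$ is called the hyperconnected quotient of $\mathcal{E}$ induced by $F$. *)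

theory Defs
  imports Main
begin

section \<open>Categories\<close>

record ('o, 'm) cat =
  Ob :: "'o set"
  Arr :: "'m set"
  Dom :: "'m \<Rightarrow> 'o"
  Cod :: "'m \<Rightarrow> 'o"
  Id :: "'o \<Rightarrow> 'm"
  Comp :: "'m \<Rightarrow> 'm \<Rightarrow> 'm"  (infixl \<open>\<cdot>\<index>\<close> 70)

text \<open>\<open>g \<cdot>\<^bsub>E\<^esub> f\<close> is \<open>g\<close> after \<open>f\<close>. All data are
  meaningful only on objects and arrows of the category, and \<open>Comp\<close> only on composable pairs.\<close>

definition hom :: "('o, 'm) cat \<Rightarrow> 'o \<Rightarrow> 'o \<Rightarrow> 'm set" where
  "hom E X Y = {f \<in> Arr E. Dom E f = X \<and> Cod E f = Y}"

definition is_category :: "('o, 'm) cat \<Rightarrow> bool" where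
  "is_category E \<longleftrightarrow>
     (\<forall>f \<in> Arr E. Dom E f \<in> Ob E \<and> Cod E f \<in> Ob E) \<and>
     (\<forall>X \<in> Ob E. Id E X \<in> hom E X X) \<and>
     (\<forall>X Y Z f g. f \<in> hom E X Y \<longrightarrow> g \<in> hom E Y Z \<longrightarrow> g \<cdot>\<^bsub>E\<^esub> f \<in> hom E X Z) \<and>
     (\<forall>X Y f. f \<in> hom E X Y \<longrightarrow> f \<cdot>\<^bsub>E\<^esub> Id E X = f \<and> Id E Y \<cdot>\<^bsub>E\<^esub> f = f) \<and>
     (\<forall>W X Y Z f g h. f \<in> hom E W X \<longrightarrow> g \<in> hom E X Y \<longrightarrow> h \<in> hom E Y Z \<longrightarrow>
        h \<cdot>\<^bsub>E\<^esub> (g \<cdot>\<^bsub>E\<^esub> f) = (h \<cdot>\<^bsub>E\<^esub> g) \<cdot>\<^bsub>E\<^esub> f)"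

definition is_mono :: "('o, 'm) cat \<Rightarrow> 'm \<Rightarrow> bool" where
  "is_mono E m \<longleftrightarrow> m \<in> Arr E \<and>
     (\<forall>A f g. f \<in> hom E A (Dom E m) \<longrightarrow> g \<in> hom E A (Dom E m) \<longrightarrow>
        m \<cdot>\<^bsub>E\<^esub> f = m \<cdot>\<^bsub>E\<^esub> g \<longrightarrow> f = g)"

definition full_subcat :: "('o, 'm) cat \<Rightarrow> 'o set \<Rightarrow> ('o, 'm) cat" where
  "full_subcat E S =
     E\<lparr>Ob := Ob E \<inter> S, Arr := {f \<in> Arr E. Dom E f \<in> S \<and> Cod E f \<in> S}\<rparr>"


section \<open>Finite limits\<close>

text \<open>A finite diagram is given by a list \<open>Xs\<close> of objects (its vertices are the positions in the
  list) and a finite set \<open>D\<close> of edges; the edge \<open>(i, j, f)\<close> is the arrow \<open>f\<close> from vertex \<open>i\<close> to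
  vertex \<open>j\<close>. With \<open>D = {}\<close> the limits are the finite products, for \<open>Xs = []\<close> terminal objects.\<close>

definition is_diagram :: "('o, 'm) cat \<Rightarrow> 'o list \<Rightarrow> (nat \<times> nat \<times> 'm) set \<Rightarrow> bool" where
  "is_diagram E Xs D \<longleftrightarrow> set Xs \<subseteq> Ob E \<and> finite D \<and>
     (\<forall>(i, j, f) \<in> D. i < length Xs \<and> j < length Xs \<and> f \<in> hom E (Xs ! i) (Xs ! j))"

definition is_cone ::
  "('o, 'm) cat \<Rightarrow> 'o list \<Rightarrow> (nat \<times> nat \<times> 'm) set \<Rightarrow> 'o \<Rightarrow> 'm list \<Rightarrow> bool" where
  "is_cone E Xs D A fs \<longleftrightarrow> A \<in> Ob E \<and> length fs = length Xs \<and>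
     (\<forall>i < length Xs. fs ! i \<in> hom E A (Xs ! i)) \<and>
     (\<forall>(i, j, f) \<in> D. f \<cdot>\<^bsub>E\<^esub> (fs ! i) = fs ! j)"

definition is_limit ::
  "('o, 'm) cat \<Rightarrow> 'o list \<Rightarrow> (nat \<times> nat \<times> 'm) set \<Rightarrow> 'o \<Rightarrow> 'm list \<Rightarrow> bool" where
  "is_limit E Xs D P ps \<longleftrightarrow> is_cone E Xs D P ps \<and>
     (\<forall>A fs. is_cone E Xs D A fs \<longrightarrow>
        (\<exists>!u. u \<in> hom E A P \<and> (\<forall>i < length Xs. (ps ! i) \<cdot>\<^bsub>E\<^esub> u = fs ! i)))"

definition has_finite_limits :: "('o, 'm) cat \<Rightarrow> bool" where
  "has_finite_limits E \<longleftrightarrow> (\<forall>Xs D. is_diagram E Xs D \<longrightarrow> (\<exists>P ps. is_limit E Xs D P ps))"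

text \<open>The square \<open>f \<cdot> p = g \<cdot> q\<close>, with corner \<open>P\<close>, is a pullback.\<close>

definition is_pullback :: "('o, 'm) cat \<Rightarrow> 'o \<Rightarrow> 'm \<Rightarrow> 'm \<Rightarrow> 'm \<Rightarrow> 'm \<Rightarrow> bool" where
  "is_pullback E P p q f g \<longleftrightarrow>
     is_limit E [Dom E f, Dom E g, Cod E f] {(0, 2, f), (1, 2, g)} P [p, q, f \<cdot>\<^bsub>E\<^esub> p]"

text \<open>A choice of finite products \<open>X\<^sub>0 \<times> \<dots> \<times> X\<^sub>n\<^sub>-\<^sub>1\<close> with projections, tuples \<open>\<langle>f\<^sub>0, \<dots>, f\<^sub>n\<^sub>-\<^sub>1\<rangle>\<close> of
  arrows out of \<open>A\<close>, and products of arrows \<open>f\<^sub>i : Xs ! i \<rightarrow> Ys ! i\<close>.\<close>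

definition fin_product :: "('o, 'm) cat \<Rightarrow> 'o list \<Rightarrow> 'o \<times> 'm list" where
  "fin_product E Xs = (SOME c. is_limit E Xs {} (fst c) (snd c))"

definition Prod :: "('o, 'm) cat \<Rightarrow> 'o list \<Rightarrow> 'o" where
  "Prod E Xs = fst (fin_product E Xs)"

definition proj :: "('o, 'm) cat \<Rightarrow> 'o list \<Rightarrow> nat \<Rightarrow> 'm" where
  "proj E Xs i = snd (fin_product E Xs) ! i"

definition tuple :: "('o, 'm) cat \<Rightarrow> 'o \<Rightarrow> 'o list \<Rightarrow> 'm list \<Rightarrow> 'm" where
  "tuple E A Xs fs =
     (THE u. u \<in> hom E A (Prod E Xs) \<and> (\<forall>i < length Xs. proj E Xs i \<cdot>\<^bsub>E\<^esub> u = fs ! i))"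

definition prod_map :: "('o, 'm) cat \<Rightarrow> 'o list \<Rightarrow> 'o list \<Rightarrow> 'm list \<Rightarrow> 'm" where
  "prod_map E Xs Ys fs =
     tuple E (Prod E Xs) Ys (map (\<lambda>i. (fs ! i) \<cdot>\<^bsub>E\<^esub> proj E Xs i) [0..<length Xs])"


section \<open>Elementary toposes\<close>

definition is_exponential :: "('o, 'm) cat \<Rightarrow> 'o \<Rightarrow> 'o \<Rightarrow> 'o \<Rightarrow> 'm \<Rightarrow> bool" where
  "is_exponential E Y Z W ev \<longleftrightarrow> W \<in> Ob E \<and> ev \<in> hom E (Prod E [W, Y]) Z \<and>
     (\<forall>A f. A \<in> Ob E \<longrightarrow> f \<in> hom E (Prod E [A, Y]) Z \<longrightarrow>
        (\<exists>!g. g \<in> hom E A W \<and> ev \<cdot>\<^bsub>E\<^esub> prod_map E [A, Y] [W, Y] [g, Id E Y] = f))"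

definition is_subobject_classifier :: "('o, 'm) cat \<Rightarrow> 'o \<Rightarrow> 'm \<Rightarrow> bool" where
  "is_subobject_classifier E Om tr \<longleftrightarrow> Om \<in> Ob E \<and> tr \<in> hom E (Prod E []) Om \<and>
     (\<forall>U X m. m \<in> hom E U X \<longrightarrow> is_mono E m \<longrightarrow>
        (\<exists>!\<chi>. \<chi> \<in> hom E X Om \<and> is_pullback E U m (tuple E U [] []) \<chi> tr))"

definition elementary_topos :: "('o, 'm) cat \<Rightarrow> bool" where
  "elementary_topos E \<longleftrightarrow> is_category E \<and> has_finite_limits E \<and>
     (\<forall>Y \<in> Ob E. \<forall>Z \<in> Ob E. \<exists>W ev. is_exponential E Y Z W ev) \<and>
     (\<exists>Om tr. is_subobject_classifier E Om tr)"


section \<open>Local state classifiers\<close>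

definition mono_cocone :: "('o, 'm) cat \<Rightarrow> 'o \<Rightarrow> ('o \<Rightarrow> 'm) \<Rightarrow> bool" where
  "mono_cocone E L \<phi> \<longleftrightarrow> L \<in> Ob E \<and> (\<forall>X \<in> Ob E. \<phi> X \<in> hom E X L) \<and>
     (\<forall>X Y m. m \<in> hom E X Y \<longrightarrow> is_mono E m \<longrightarrow> \<phi> Y \<cdot>\<^bsub>E\<^esub> m = \<phi> X)"

definition local_state_classifier :: "('o, 'm) cat \<Rightarrow> 'o \<Rightarrow> ('o \<Rightarrow> 'm) \<Rightarrow> bool" where
  "local_state_classifier E \<Xi> \<xi> \<longleftrightarrow> mono_cocone E \<Xi> \<xi> \<and>
     (\<forall>L \<phi>. mono_cocone E L \<phi> \<longrightarrow>
        (\<exists>!u. u \<in> hom E \<Xi> L \<and> (\<forall>X \<in> Ob E. u \<cdot>\<^bsub>E\<^esub> \<xi> X = \<phi> X)))"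


section \<open>The order structure and internal filters\<close>

text \<open>Operations on \<open>hom E X \<Xi>\<close> induced by \<open>\<mu> : \<Xi> \<times> \<Xi> \<rightarrow> \<Xi>\<close> and \<open>t : 1 \<rightarrow> \<Xi>\<close>.\<close>

definition hom_meet :: "('o, 'm) cat \<Rightarrow> 'o \<Rightarrow> 'm \<Rightarrow> 'o \<Rightarrow> 'm \<Rightarrow> 'm \<Rightarrow> 'm" where
  "hom_meet E \<Xi> \<mu> X f g = \<mu> \<cdot>\<^bsub>E\<^esub> tuple E X [\<Xi>, \<Xi>] [f, g]"

definition hom_top :: "('o, 'm) cat \<Rightarrow> 'm \<Rightarrow> 'o \<Rightarrow> 'm" where
  "hom_top E t X = t \<cdot>\<^bsub>E\<^esub> tuple E X [] []"

text \<open>The semilattice equations are stated for generalized elements; for the projections out of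
  \<open>\<Xi>\<^sup>3\<close>, \<open>\<Xi>\<^sup>2\<close> and \<open>\<Xi>\<close> they are the usual commutative diagrams.\<close>

definition internal_meet_semilattice :: "('o, 'm) cat \<Rightarrow> 'o \<Rightarrow> 'm \<Rightarrow> 'm \<Rightarrow> bool" where
  "internal_meet_semilattice E \<Xi> \<mu> t \<longleftrightarrow>
     \<mu> \<in> hom E (Prod E [\<Xi>, \<Xi>]) \<Xi> \<and> t \<in> hom E (Prod E []) \<Xi> \<and>
     (\<forall>X \<in> Ob E. \<forall>f \<in> hom E X \<Xi>. \<forall>g \<in> hom E X \<Xi>. \<forall>h \<in> hom E X \<Xi>.
        hom_meet E \<Xi> \<mu> X (hom_meet E \<Xi> \<mu> X f g) h = hom_meet E \<Xi> \<mu> X f (hom_meet E \<Xi> \<mu> X g h) \<and>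
        hom_meet E \<Xi> \<mu> X f g = hom_meet E \<Xi> \<mu> X g f \<and>
        hom_meet E \<Xi> \<mu> X f f = f \<and>
        hom_meet E \<Xi> \<mu> X f (hom_top E t X) = f)"

text \<open>The \<open>n\<close>-ary meet \<open>\<Xi>\<^sup>n \<rightarrow> \<Xi>\<close>.\<close>

definition nary_meet :: "('o, 'm) cat \<Rightarrow> 'o \<Rightarrow> 'm \<Rightarrow> 'm \<Rightarrow> nat \<Rightarrow> 'm" where
  "nary_meet E \<Xi> \<mu> t n =
     (let \<Xi>n = replicate n \<Xi>; Q = Prod E \<Xi>n
      in foldr (hom_meet E \<Xi> \<mu> Q) (map (proj E \<Xi>n) [0..<n]) (hom_top E t Q))"

definition is_lsc_order :: "('o, 'm) cat \<Rightarrow> 'o \<Rightarrow> ('o \<Rightarrow> 'm) \<Rightarrow> 'm \<Rightarrow> 'm \<Rightarrow> bool" where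
  "is_lsc_order E \<Xi> \<xi> \<mu> t \<longleftrightarrow> internal_meet_semilattice E \<Xi> \<mu> t \<and>
     (\<forall>Xs. set Xs \<subseteq> Ob E \<longrightarrow>
        nary_meet E \<Xi> \<mu> t (length Xs)
          \<cdot>\<^bsub>E\<^esub> prod_map E Xs (replicate (length Xs) \<Xi>) (map \<xi> Xs) = \<xi> (Prod E Xs))"

text \<open>If \<open>E\<close> is cartesian closed and \<open>\<xi>\<close> is a local state classifier with vertex \<open>\<Xi>\<close>, there is
  exactly one such pair \<open>(\<mu>, t)\<close>, so the following description is proper.\<close>

definition lsc_order :: "('o, 'm) cat \<Rightarrow> 'o \<Rightarrow> ('o \<Rightarrow> 'm) \<Rightarrow> 'm \<times> 'm" where
  "lsc_order E \<Xi> \<xi> = (THE s. is_lsc_order E \<Xi> \<xi> (fst s) (snd s))"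

definition lsc_meet :: "('o, 'm) cat \<Rightarrow> 'o \<Rightarrow> ('o \<Rightarrow> 'm) \<Rightarrow> 'o \<Rightarrow> 'm \<Rightarrow> 'm \<Rightarrow> 'm" where
  "lsc_meet E \<Xi> \<xi> X f g = hom_meet E \<Xi> (fst (lsc_order E \<Xi> \<xi>)) X f g"

definition lsc_top :: "('o, 'm) cat \<Rightarrow> 'o \<Rightarrow> ('o \<Rightarrow> 'm) \<Rightarrow> 'o \<Rightarrow> 'm" where
  "lsc_top E \<Xi> \<xi> X = hom_top E (snd (lsc_order E \<Xi> \<xi>)) X"

definition lsc_le :: "('o, 'm) cat \<Rightarrow> 'o \<Rightarrow> ('o \<Rightarrow> 'm) \<Rightarrow> 'o \<Rightarrow> 'm \<Rightarrow> 'm \<Rightarrow> bool" where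
  "lsc_le E \<Xi> \<xi> X f g \<longleftrightarrow> lsc_meet E \<Xi> \<xi> X f g = f"

text \<open>Arrows from \<open>X\<close> to the codomain of \<open>\<iota>\<close> that factor through \<open>\<iota> : F \<rightarrow> \<Xi>\<close>.\<close>

definition factoring :: "('o, 'm) cat \<Rightarrow> 'o \<Rightarrow> 'm \<Rightarrow> 'o \<Rightarrow> 'm set" where
  "factoring E F \<iota> X = (\<lambda>h. \<iota> \<cdot>\<^bsub>E\<^esub> h) ` hom E X F"

definition internal_filter ::
  "('o, 'm) cat \<Rightarrow> 'o \<Rightarrow> ('o \<Rightarrow> 'm) \<Rightarrow> 'o \<Rightarrow> 'm \<Rightarrow> bool" where
  "internal_filter E \<Xi> \<xi> F \<iota> \<longleftrightarrow> \<iota> \<in> hom E F \<Xi> \<and> is_mono E \<iota> \<and>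
     (\<forall>X \<in> Ob E.
        (\<forall>f \<in> factoring E F \<iota> X. \<forall>g \<in> hom E X \<Xi>.
           lsc_le E \<Xi> \<xi> X f g \<longrightarrow> g \<in> factoring E F \<iota> X) \<and>
        lsc_top E \<Xi> \<xi> X \<in> factoring E F \<iota> X \<and>
        (\<forall>f \<in> factoring E F \<iota> X. \<forall>g \<in> factoring E F \<iota> X.
           lsc_meet E \<Xi> \<xi> X f g \<in> factoring E F \<iota> X))"


section \<open>The quotient induced by an internal filter\<close>

definition filter_quotient ::
  "('o, 'm) cat \<Rightarrow> ('o \<Rightarrow> 'm) \<Rightarrow> 'o \<Rightarrow> 'm \<Rightarrow> ('o, 'm) cat" where
  "filter_quotient E \<xi> F \<iota> = full_subcat E {X \<in> Ob E. \<xi> X \<in> factoring E F \<iota> X}"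

definition restricted_lsc ::
  "('o, 'm) cat \<Rightarrow> ('o \<Rightarrow> 'm) \<Rightarrow> 'o \<Rightarrow> 'm \<Rightarrow> 'o \<Rightarrow> 'm" where
  "restricted_lsc E \<xi> F \<iota> Z = (THE h. h \<in> hom E Z F \<and> \<iota> \<cdot>\<^bsub>E\<^esub> h = \<xi> Z)"

end

theory Submission
  imports Defs
begin

text \<open>Write \<open>A\<^sub>X\<close> for the pullback of \<open>F\<close> along \<open>\<xi> X\<close>; it is the largest subobject of \<open>X\<close> lying in
  \<open>E\<^sub>F\<close>. A cocone \<open>\<phi>\<close> over the monomorphisms of \<open>E\<^sub>F\<close> gives partial maps from \<open>X\<close> to \<open>L\<close> with domain
  \<open>A\<^sub>X\<close>, whose graphs are stable under pullback along monomorphisms. Since \<open>E\<close> is cartesian closed,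
  \<open>(_) \<times> L\<close> preserves the colimit \<open>\<Xi>\<close>, so the characteristic maps of these graphs glue to a relation
  between \<open>\<Xi>\<close> and \<open>L\<close>. That it is the graph of a map \<open>F \<rightarrow> L\<close>, and that this map is unique, are
  equalities of subobjects of products \<open>\<Xi> \<times> Z\<close>, which can be checked after pullback along all
  \<open>\<xi> X \<times> Z\<close>. That \<open>F\<close> itself lies in \<open>E\<^sub>F\<close> holds because the graph of any \<open>f : X \<rightarrow> Y\<close> is monic, so
  that \<open>\<xi> X \<le> \<xi> Y \<cdot> f\<close>; this yields \<open>id \<le> \<xi> \<Xi>\<close>, hence \<open>\<iota> \<le> \<xi> F\<close>.\<close>

section \<open>Finite limits, elementwise\<close>

text \<open>The obstacle is that \<open>\<phi>\<close> has no component at objects outside the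
  quotient, so the universal property of \<Xi> cannot be applied to it directly. A relation to
  \<open>L\<close> has no such defect: where the partial map is undefined, the relation is empty.
  Hence the detour through maps into the subobject classifier, followed by a proof that the glued
  relation is single-valued with domain \<open>F\<close>. The colimit \<Xi> may be large, so it is
  not presented as a quotient of a coproduct of the objects \<open>X\<close>; only its universal
  property is at hand. It makes the maps \<open>\<xi> X\<close> jointly epic, also after multiplying
  by a fixed object, and the subobject classifier turns this into a test for inclusions of
  subobjects. The filter axioms speak of a meet given by definite description, so they yield nothing
  until that meet is shown to exist uniquely. Its study rests on one rule: the meet of
  \<open>\<xi> X \<cdot> x\<close> and \<open>\<xi> Y \<cdot> y\<close> is
  \<open>\<xi> (X \<otimes> Y)\<close> at the pair of \<open>x\<close> and \<open>y\<close>. As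
  \<open>\<xi>\<close> is invariant under monomorphisms, each semilattice law becomes the existence
  of a particular monomorphism between products.\<close>

locale finlim_category =
  fixes E :: "('o, 'm) cat" (structure)
  assumes category: "is_category E" and limits: "has_finite_limits E"
begin

lemma hom_iff: "f \<in> hom E X Y \<longleftrightarrow> f \<in> Arr E \<and> Dom E f = X \<and> Cod E f = Y"
  by (simp add: hom_def)

lemma Dom_Ob [simp]: "f \<in> Arr E \<Longrightarrow> Dom E f \<in> Ob E"
  and Cod_Ob [simp]: "f \<in> Arr E \<Longrightarrow> Cod E f \<in> Ob E"
  using category by (auto simp: is_category_def)

lemma Id_hom: "X \<in> Ob E \<Longrightarrow> Id E X \<in> hom E X X"
  using category by (auto simp: is_category_def)

lemma Id_typing [simp]:
  assumes "X \<in> Ob E"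
  shows "Id E X \<in> Arr E" "Dom E (Id E X) = X" "Cod E (Id E X) = X"
  using Id_hom[OF assms] by (auto simp: hom_iff)

lemma comp_hom: "f \<in> hom E X Y \<Longrightarrow> g \<in> hom E Y Z \<Longrightarrow> g \<cdot> f \<in> hom E X Z"
  using category unfolding is_category_def by blast

lemma comp_typing [simp]:
  assumes "f \<in> Arr E" "g \<in> Arr E" "Dom E g = Cod E f"
  shows "g \<cdot> f \<in> Arr E" "Dom E (g \<cdot> f) = Dom E f" "Cod E (g \<cdot> f) = Cod E g"
  using comp_hom[of f "Dom E f" "Cod E f" g "Cod E g"] assms by (auto simp: hom_iff)

lemma comp_assoc [simp]:
  assumes "f \<in> Arr E" "g \<in> Arr E" "h \<in> Arr E" "Dom E g = Cod E f" "Dom E h = Cod E g"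
  shows "(h \<cdot> g) \<cdot> f = h \<cdot> (g \<cdot> f)"
proof -
  have "\<forall>W X Y Z f g h. f \<in> hom E W X \<longrightarrow> g \<in> hom E X Y \<longrightarrow> h \<in> hom E Y Z \<longrightarrow>
      h \<cdot> (g \<cdot> f) = (h \<cdot> g) \<cdot> f"
    using category unfolding is_category_def by blast
  with assms show ?thesis by (auto simp: hom_iff)
qed

lemma comp_Id [simp]: "f \<in> Arr E \<Longrightarrow> Dom E f = X \<Longrightarrow> f \<cdot> Id E X = f"
  and Id_comp [simp]: "f \<in> Arr E \<Longrightarrow> Cod E f = X \<Longrightarrow> Id E X \<cdot> f = f"
proof -
  have *: "\<forall>X Y f. f \<in> hom E X Y \<longrightarrow> f \<cdot> Id E X = f \<and> Id E Y \<cdot> f = f"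
    using category unfolding is_category_def by blast
  show "f \<in> Arr E \<Longrightarrow> Dom E f = X \<Longrightarrow> f \<cdot> Id E X = f"
    and "f \<in> Arr E \<Longrightarrow> Cod E f = X \<Longrightarrow> Id E X \<cdot> f = f"
    using * by (auto simp: hom_iff)
qed

text \<open>\<open>comp_assoc\<close> as a simplification rule reassociates to the right, which
  hides the composite \<open>a \<cdot> b\<close> inside \<open>a \<cdot> (b \<cdot> k)\<close>. This
  lemma and the next apply an equation between composites in that position.\<close>

lemma comp_eq_comp:
  assumes "a \<cdot> b = c \<cdot> d" "a \<in> Arr E" "b \<in> Arr E" "c \<in> Arr E" "d \<in> Arr E" "k \<in> Arr E"
    "Dom E a = Cod E b" "Dom E c = Cod E d" "Dom E b = Cod E k" "Dom E d = Cod E k"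
  shows "a \<cdot> (b \<cdot> k) = c \<cdot> (d \<cdot> k)"
proof -
  have "a \<cdot> (b \<cdot> k) = (a \<cdot> b) \<cdot> k" using assms(2-) by simp
  also have "\<dots> = (c \<cdot> d) \<cdot> k" by (simp add: assms(1))
  finally show ?thesis using assms(2-) by simp
qed

lemma comp_eq:
  assumes "a \<cdot> b = c" "a \<in> Arr E" "b \<in> Arr E" "k \<in> Arr E" "Dom E a = Cod E b" "Dom E b = Cod E k"
  shows "a \<cdot> (b \<cdot> k) = c \<cdot> k"
proof -
  have "a \<cdot> (b \<cdot> k) = (a \<cdot> b) \<cdot> k" using assms(2-) by simp
  then show ?thesis by (simp add: assms(1))
qed

lemma monoI:
  assumes "m \<in> hom E X Y"
    and "\<And>A f g. f \<in> hom E A X \<Longrightarrow> g \<in> hom E A X \<Longrightarrow> m \<cdot> f = m \<cdot> g \<Longrightarrow> f = g"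
  shows "is_mono E m"
  unfolding is_mono_def using assms by (auto simp: hom_iff)

lemma monoD:
  assumes "is_mono E m" "m \<cdot> f = m \<cdot> g" "f \<in> hom E A X" "g \<in> hom E A X" "m \<in> hom E X Y"
  shows "f = g"
  using assms unfolding is_mono_def by (auto simp: hom_iff)

lemma split_mono:
  assumes "m \<in> hom E X Y" "r \<in> hom E Y X" "r \<cdot> m = Id E X"
  shows "is_mono E m"
proof (rule monoI[OF assms(1)])
  fix A f g assume f: "f \<in> hom E A X" and g: "g \<in> hom E A X" and eq: "m \<cdot> f = m \<cdot> g"
  have "r \<cdot> (m \<cdot> h) = h" if "h \<in> hom E A X" for h
  proof -
    have "r \<cdot> (m \<cdot> h) = Id E X \<cdot> h"
      by (rule comp_eq[OF assms(3)]) (use assms(1,2) that in \<open>simp_all add: hom_iff\<close>)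
    then show ?thesis using that by (simp add: hom_iff)
  qed
  from this[OF f] this[OF g] eq show "f = g" by metis
qed

section \<open>Chosen finite products and their generalized elements\<close>

lemma Prod_limit:
  assumes "set Xs \<subseteq> Ob E"
  shows "is_limit E Xs {} (Prod E Xs) (snd (fin_product E Xs))"
proof -
  have "is_diagram E Xs {}" using assms by (simp add: is_diagram_def)
  with limits obtain P ps where "is_limit E Xs {} P ps" unfolding has_finite_limits_def by blast
  then have "is_limit E Xs {} (fst (P, ps)) (snd (P, ps))" by simp
  then show ?thesis unfolding Prod_def fin_product_def by (rule someI)
qed

lemma Prod_Ob [simp]: "set Xs \<subseteq> Ob E \<Longrightarrow> Prod E Xs \<in> Ob E"
  using Prod_limit unfolding is_limit_def is_cone_def by blast

lemma proj_hom:
  assumes "set Xs \<subseteq> Ob E" "i < length Xs"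
  shows "proj E Xs i \<in> hom E (Prod E Xs) (Xs ! i)"
  using Prod_limit[OF assms(1)] assms(2) unfolding is_limit_def is_cone_def proj_def by blast

lemma tuple_ex1:
  assumes "set Xs \<subseteq> Ob E" "A \<in> Ob E" "length fs = length Xs"
    "\<And>i. i < length Xs \<Longrightarrow> fs ! i \<in> hom E A (Xs ! i)"
  shows "\<exists>!u. u \<in> hom E A (Prod E Xs) \<and> (\<forall>i < length Xs. proj E Xs i \<cdot> u = fs ! i)"
proof -
  have "is_cone E Xs {} A fs" using assms by (simp add: is_cone_def)
  with Prod_limit[OF assms(1)] show ?thesis unfolding is_limit_def proj_def by blast
qed

lemma tuple:
  assumes "set Xs \<subseteq> Ob E" "A \<in> Ob E" "length fs = length Xs"
    "\<And>i. i < length Xs \<Longrightarrow> fs ! i \<in> hom E A (Xs ! i)"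
  shows tuple_hom: "tuple E A Xs fs \<in> hom E A (Prod E Xs)"
    and proj_tuple: "i < length Xs \<Longrightarrow> proj E Xs i \<cdot> tuple E A Xs fs = fs ! i"
  using theI'[OF tuple_ex1[OF assms]] unfolding tuple_def by auto

lemma Prod_eqI:
  assumes "set Xs \<subseteq> Ob E" "u \<in> hom E A (Prod E Xs)" "v \<in> hom E A (Prod E Xs)"
    "\<And>i. i < length Xs \<Longrightarrow> proj E Xs i \<cdot> u = proj E Xs i \<cdot> v"
  shows "u = v"
proof -
  let ?fs = "map (\<lambda>i. proj E Xs i \<cdot> v) [0..<length Xs]"
  have "A \<in> Ob E" using assms(2) by (auto simp: hom_iff)
  moreover have "\<And>i. i < length Xs \<Longrightarrow> ?fs ! i \<in> hom E A (Xs ! i)"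
    using proj_hom[OF assms(1)] assms(3) by (auto intro: comp_hom)
  ultimately have "\<exists>!u. u \<in> hom E A (Prod E Xs) \<and> (\<forall>i < length Xs. proj E Xs i \<cdot> u = ?fs ! i)"
    by (intro tuple_ex1 assms(1)) auto
  moreover have "\<forall>i < length Xs. proj E Xs i \<cdot> u = ?fs ! i" 
    "\<forall>i < length Xs. proj E Xs i \<cdot> v = ?fs ! i" using assms(4) by auto
  ultimately show ?thesis using assms(2,3) by blast
qed

abbreviation bang :: "'o \<Rightarrow> 'm" where "bang A \<equiv> tuple E A [] []"

lemma bang_typing [simp]:
  assumes "A \<in> Ob E"
  shows "bang A \<in> Arr E" "Dom E (bang A) = A" "Cod E (bang A) = Prod E []"
  using tuple_hom[of "[]" A "[]"] assms by (auto simp: hom_iff)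

lemma bang_eqI: "u \<in> hom E A (Prod E []) \<Longrightarrow> v \<in> hom E A (Prod E []) \<Longrightarrow> u = v"
  by (rule Prod_eqI[of "[]"]) auto

lemma bang_comp [simp]:
  "f \<in> Arr E \<Longrightarrow> Cod E f = A \<Longrightarrow> bang A \<cdot> f = bang (Dom E f)"
  by (rule bang_eqI[of _ "Dom E f"]) (auto simp: hom_iff)

abbreviation prod2 :: "'o \<Rightarrow> 'o \<Rightarrow> 'o" (infixr \<open>\<otimes>\<close> 75) where "X \<otimes> Y \<equiv> Prod E [X, Y]"
abbreviation p1 :: "'o \<Rightarrow> 'o \<Rightarrow> 'm" where "p1 X Y \<equiv> proj E [X, Y] 0"
abbreviation p2 :: "'o \<Rightarrow> 'o \<Rightarrow> 'm" where "p2 X Y \<equiv> proj E [X, Y] (Suc 0)"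

text \<open>All objects are read off from the arrows, so equations between pairs carry no object
  annotations that could block rewriting.\<close>

definition pair :: "'m \<Rightarrow> 'm \<Rightarrow> 'm" where
  "pair f g = tuple E (Dom E f) [Cod E f, Cod E g] [f, g]"

lemma p_typing [simp]:
  assumes "X \<in> Ob E" "Y \<in> Ob E"
  shows "p1 X Y \<in> Arr E" "Dom E (p1 X Y) = X \<otimes> Y" "Cod E (p1 X Y) = X"
    "p2 X Y \<in> Arr E" "Dom E (p2 X Y) = X \<otimes> Y" "Cod E (p2 X Y) = Y"
  using proj_hom[of "[X, Y]" 0] proj_hom[of "[X, Y]" 1] assms by (auto simp: hom_iff)

lemma pair_facts [simp]:
  assumes "f \<in> Arr E" "g \<in> Arr E" "Dom E f = Dom E g"
  shows "pair f g \<in> Arr E" "Dom E (pair f g) = Dom E g" "Cod E (pair f g) = Cod E f \<otimes> Cod E g"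
    and p1_pair: "Cod E f = X \<Longrightarrow> Cod E g = Y \<Longrightarrow> p1 X Y \<cdot> pair f g = f"
    and p2_pair: "Cod E f = X \<Longrightarrow> Cod E g = Y \<Longrightarrow> p2 X Y \<cdot> pair f g = g"
proof -
  have *: "\<And>i. i < length [Cod E f, Cod E g] \<Longrightarrow> [f, g] ! i \<in> hom E (Dom E f) ([Cod E f, Cod E g] ! i)"
    using assms by (auto simp: hom_iff less_Suc_eq)
  have ob: "set [Cod E f, Cod E g] \<subseteq> Ob E" "Dom E f \<in> Ob E" using assms by auto
  note t = tuple[OF ob _ *]
  show "pair f g \<in> Arr E" "Dom E (pair f g) = Dom E g" "Cod E (pair f g) = Cod E f \<otimes> Cod E g"
    using t(1) assms(3) unfolding pair_def by (auto simp: hom_iff)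
  show "Cod E f = X \<Longrightarrow> Cod E g = Y \<Longrightarrow> p1 X Y \<cdot> pair f g = f"
    "Cod E f = X \<Longrightarrow> Cod E g = Y \<Longrightarrow> p2 X Y \<cdot> pair f g = g"
    using t(2)[of 0] t(2)[of 1] unfolding pair_def by auto
qed

lemma pair_eqI:
  assumes "u \<in> hom E A (X \<otimes> Y)" "v \<in> hom E A (X \<otimes> Y)" "X \<in> Ob E" "Y \<in> Ob E"
    "p1 X Y \<cdot> u = p1 X Y \<cdot> v" "p2 X Y \<cdot> u = p2 X Y \<cdot> v"
  shows "u = v"
  by (rule Prod_eqI[of "[X, Y]" u A v]) (use assms in \<open>auto simp: less_Suc_eq\<close>)

lemma pair_inject:
  assumes "pair f g = pair f' g'" "f \<in> hom E A X" "f' \<in> hom E A X" "g \<in> hom E A Y" "g' \<in> hom E A Y"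
  shows "f = f'" "g = g'"
proof -
  have "p1 X Y \<cdot> pair f g = p1 X Y \<cdot> pair f' g'" "p2 X Y \<cdot> pair f g = p2 X Y \<cdot> pair f' g'"
    using assms(1) by auto
  then show "f = f'" "g = g'" using assms(2-) by (auto simp: hom_iff)
qed

lemma pair_comp [simp]:
  assumes "f \<in> Arr E" "g \<in> Arr E" "Dom E f = Dom E g" "h \<in> Arr E" "Cod E h = Dom E g"
  shows "pair f g \<cdot> h = pair (f \<cdot> h) (g \<cdot> h)"
  by (rule pair_eqI[of _ "Dom E h" "Cod E f" "Cod E g"])
    (use assms in \<open>auto simp: hom_iff comp_eq[OF p1_pair] comp_eq[OF p2_pair]\<close>)

lemma pair_projs [simp]:
  assumes "X \<in> Ob E" "Y \<in> Ob E"
  shows "pair (p1 X Y) (p2 X Y) = Id E (X \<otimes> Y)"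
  by (rule pair_eqI[of _ "X \<otimes> Y" X Y]) (use assms in \<open>auto simp: hom_iff\<close>)

lemma pair_eta [simp]:
  assumes "u \<in> Arr E" "Cod E u = X \<otimes> Y" "X \<in> Ob E" "Y \<in> Ob E"
  shows "pair (p1 X Y \<cdot> u) (p2 X Y \<cdot> u) = u"
  by (rule pair_eqI[of _ "Dom E u" X Y]) (use assms in \<open>auto simp: hom_iff\<close>)

text \<open>The last premise is joint monicity of \<open>f\<close> and \<open>g\<close>. It covers
  graphs, where one leg is already monic, and kernel pairs, where in general neither is.\<close>

lemma pair_mono:
  assumes "f \<in> hom E A X" "g \<in> hom E A Y"
    and "\<And>T a b. a \<in> hom E T A \<Longrightarrow> b \<in> hom E T A \<Longrightarrow> f \<cdot> a = f \<cdot> b \<Longrightarrow> g \<cdot> a = g \<cdot> b \<Longrightarrow> a = b"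
  shows "is_mono E (pair f g)"
proof (rule monoI[of _ A "X \<otimes> Y"])
  show "pair f g \<in> hom E A (X \<otimes> Y)" using assms by (auto simp: hom_iff)
  fix T a b assume ab: "a \<in> hom E T A" "b \<in> hom E T A" and "pair f g \<cdot> a = pair f g \<cdot> b"
  then have eq: "pair (f \<cdot> a) (g \<cdot> a) = pair (f \<cdot> b) (g \<cdot> b)" using assms by (auto simp: hom_iff)
  show "a = b"
    by (rule assms(3)[OF ab])
      (rule pair_inject[OF eq]; use ab assms(1,2) in \<open>auto intro: comp_hom\<close>)+
qed

lemma Id_mono: "X \<in> Ob E \<Longrightarrow> is_mono E (Id E X)"
  by (rule split_mono[of _ X X "Id E X"]) (simp_all add: Id_hom)

lemma product_mono:
  assumes m: "m \<in> hom E X X'" "is_mono E m" and n: "n \<in> hom E Y Y'" "is_mono E n"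
  shows "is_mono E (pair (m \<cdot> p1 X Y) (n \<cdot> p2 X Y))"
proof -
  have ob: "X \<in> Ob E" "Y \<in> Ob E" using m n by (auto simp: hom_iff)
  then have p: "p1 X Y \<in> hom E (X \<otimes> Y) X" "p2 X Y \<in> hom E (X \<otimes> Y) Y" by (simp_all add: hom_iff)
  show ?thesis
  proof (rule pair_mono[OF comp_hom[OF p(1) m(1)] comp_hom[OF p(2) n(1)]])
    fix T a b assume a: "a \<in> hom E T (X \<otimes> Y)" and b: "b \<in> hom E T (X \<otimes> Y)"
    have "(m \<cdot> p1 X Y) \<cdot> c = m \<cdot> (p1 X Y \<cdot> c)" "(n \<cdot> p2 X Y) \<cdot> c = n \<cdot> (p2 X Y \<cdot> c)"
      if "c \<in> hom E T (X \<otimes> Y)" for c using that m(1) n(1) ob by (simp_all add: hom_iff)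
    note assoc = this[OF a] this[OF b]
    assume eq: "(m \<cdot> p1 X Y) \<cdot> a = (m \<cdot> p1 X Y) \<cdot> b" "(n \<cdot> p2 X Y) \<cdot> a = (n \<cdot> p2 X Y) \<cdot> b"
    show "a = b"
    proof (rule pair_eqI[OF a b ob])
      show "p1 X Y \<cdot> a = p1 X Y \<cdot> b"
        using monoD[OF m(2) eq(1)[unfolded assoc] comp_hom[OF a p(1)] comp_hom[OF b p(1)] m(1)] .
      show "p2 X Y \<cdot> a = p2 X Y \<cdot> b"
        using monoD[OF n(2) eq(2)[unfolded assoc] comp_hom[OF a p(2)] comp_hom[OF b p(2)] n(1)] .
    qed
  qed
qed

section \<open>Pullbacks as conditions on generalized elements\<close>

text \<open>The limit has three legs, the third being determined as \<open>f \<cdot> p\<close>.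
  Existence and uniqueness of the mediating arrow are therefore stated for two legs, and separately,
  since uniqueness alone is joint monicity.\<close>

lemma pullback:
  assumes "f \<in> hom E X Z" "g \<in> hom E Y Z"
  obtains P p q where "p \<in> hom E P X" "q \<in> hom E P Y" "f \<cdot> p = g \<cdot> q"
    "\<And>T a b. a \<in> hom E T X \<Longrightarrow> b \<in> hom E T Y \<Longrightarrow> f \<cdot> a = g \<cdot> b \<Longrightarrow>
       \<exists>w \<in> hom E T P. p \<cdot> w = a \<and> q \<cdot> w = b"
    "\<And>T w w'. w \<in> hom E T P \<Longrightarrow> w' \<in> hom E T P \<Longrightarrow> p \<cdot> w = p \<cdot> w' \<Longrightarrow> q \<cdot> w = q \<cdot> w' \<Longrightarrow> w = w'"
proof -
  let ?Xs = "[X, Y, Z]" and ?D = "{(0, 2, f), (1, 2, g)} :: (nat \<times> nat \<times> 'm) set"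
  have "is_diagram E ?Xs ?D" using assms by (auto simp: is_diagram_def hom_iff)
  with limits obtain P ps where lim: "is_limit E ?Xs ?D P ps" unfolding has_finite_limits_def by blast
  let ?p = "ps ! 0" and ?q = "ps ! 1"
  have cone: "is_cone E ?Xs ?D P ps" using lim by (simp add: is_limit_def)
  then have ps: "\<And>i. i < 3 \<Longrightarrow> ps ! i \<in> hom E P (?Xs ! i)"
    by (auto simp: is_cone_def)
  from ps[of 0] ps[of 1] have p: "?p \<in> hom E P X" and q: "?q \<in> hom E P Y" by auto
  have fp: "f \<cdot> ?p = ps ! 2" "g \<cdot> ?q = ps ! 2" using cone by (auto simp: is_cone_def)
  have ex1: "\<exists>!w. w \<in> hom E T P \<and> ?p \<cdot> w = a \<and> ?q \<cdot> w = b"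
    if ab: "a \<in> hom E T X" "b \<in> hom E T Y" "f \<cdot> a = g \<cdot> b" for T a b
  proof -
    have "is_cone E ?Xs ?D T [a, b, f \<cdot> a]"
      using ab assms by (auto simp: is_cone_def less_Suc_eq hom_iff)
    with lim have ex: "\<exists>!u. u \<in> hom E T P \<and> (\<forall>i < length ?Xs. (ps ! i) \<cdot> u = [a, b, f \<cdot> a] ! i)"
      unfolding is_limit_def by (elim conjE allE impE)
    have "ps ! 2 \<cdot> u = f \<cdot> a" if "u \<in> hom E T P" "?p \<cdot> u = a" for u
      using that p assms(1) by (simp add: hom_iff flip: fp(1))
    then have "(u \<in> hom E T P \<and> (\<forall>i < length ?Xs. (ps ! i) \<cdot> u = [a, b, f \<cdot> a] ! i)) \<longleftrightarrow>
        u \<in> hom E T P \<and> ?p \<cdot> u = a \<and> ?q \<cdot> u = b" for u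
      by (auto simp: less_Suc_eq numeral_2_eq_2)
    with ex show ?thesis by simp
  qed
  show thesis
  proof (rule that[OF p q])
    show "f \<cdot> ?p = g \<cdot> ?q" using fp by simp
    show "\<exists>w \<in> hom E T P. ?p \<cdot> w = a \<and> ?q \<cdot> w = b"
      if "a \<in> hom E T X" "b \<in> hom E T Y" "f \<cdot> a = g \<cdot> b" for T a b
      using ex1[OF that] by blast
    show "w = w'" if w: "w \<in> hom E T P" "w' \<in> hom E T P" "?p \<cdot> w = ?p \<cdot> w'" "?q \<cdot> w = ?q \<cdot> w'" for T w w'
    proof -
      have "f \<cdot> (?p \<cdot> w) = g \<cdot> (?q \<cdot> w)"
        by (rule comp_eq_comp) (use w(1) p q fp assms in \<open>simp_all add: hom_iff\<close>)
      from ex1[OF comp_hom[OF w(1) p] comp_hom[OF w(1) q] this] w show ?thesis by metis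
    qed
  qed
qed

text \<open>The terminal leg of a cone carries no information, so the pullback property says which
  generalized elements of \<open>X\<close> satisfy the predicate \<chi>: exactly those that factor
  through \<open>m\<close>. Every later use of the classifier is phrased in this way.\<close>

lemma is_pullback_truth_iff:
  assumes m: "m \<in> hom E U X" "is_mono E m"
    and \<chi>: "\<chi> \<in> hom E X Om" and tr: "tr \<in> hom E (Prod E []) Om"
  shows "is_pullback E U m (bang U) \<chi> tr \<longleftrightarrow>
    (\<forall>T. \<forall>x \<in> hom E T X. \<chi> \<cdot> x = tr \<cdot> bang T \<longleftrightarrow> (\<exists>w \<in> hom E T U. m \<cdot> w = x))"
    (is "?L \<longleftrightarrow> ?R")
proof
  let ?Xs = "[X, Prod E [], Om]" and ?D = "{(0, 2, \<chi>), (1, 2, tr)} :: (nat \<times> nat \<times> 'm) set"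
  have pb: "?L \<longleftrightarrow> is_limit E ?Xs ?D U [m, bang U, \<chi> \<cdot> m]"
    using \<chi> tr by (simp add: is_pullback_def hom_iff)
  have U: "U \<in> Ob E" using m by (auto simp: hom_iff)
  show ?R if ?L
  proof (intro allI ballI iffI)
    fix T x assume x: "x \<in> hom E T X"
    then have T: "T \<in> Ob E" by (auto simp: hom_iff)
    show "\<exists>w \<in> hom E T U. m \<cdot> w = x" if eq: "\<chi> \<cdot> x = tr \<cdot> bang T"
    proof -
      have "is_cone E ?Xs ?D T [x, bang T, \<chi> \<cdot> x]"
        using x T \<chi> tr eq by (auto simp: is_cone_def less_Suc_eq hom_iff)
      with \<open>?L\<close> pb obtain u where u: "u \<in> hom E T U"
          "\<forall>i < length ?Xs. ([m, bang U, \<chi> \<cdot> m] ! i) \<cdot> u = [x, bang T, \<chi> \<cdot> x] ! i"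
        unfolding is_limit_def by blast
      from u(2)[rule_format, of 0] u(1) show ?thesis by auto
    qed
    show "\<chi> \<cdot> x = tr \<cdot> bang T" if "\<exists>w \<in> hom E T U. m \<cdot> w = x"
    proof -
      from that obtain w where w: "w \<in> hom E T U" "m \<cdot> w = x" by blast
      have "\<chi> \<cdot> m = tr \<cdot> bang U" using \<open>?L\<close> pb by (auto simp: is_limit_def is_cone_def)
      then have "\<chi> \<cdot> (m \<cdot> w) = tr \<cdot> (bang U \<cdot> w)"
        by (rule comp_eq_comp) (use w(1) m \<chi> tr U in \<open>simp_all add: hom_iff\<close>)
      then show ?thesis using w U by (simp add: hom_iff)
    qed
  qed
  show ?L if R: ?R
  proof -
    \<comment> \<open>The criterion is applied to the element \<open>m\<close> itself, which factors
      through \<open>m\<close> by the identity.\<close>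
    have "\<chi> \<cdot> m = tr \<cdot> bang U"
      using R m U by (auto simp: hom_iff intro!: bexI[of _ "Id E U"])
    then have cone: "is_cone E ?Xs ?D U [m, bang U, \<chi> \<cdot> m]"
      using m U \<chi> tr by (auto simp: is_cone_def less_Suc_eq hom_iff)
    moreover have "\<exists>!u. u \<in> hom E A U \<and> (\<forall>i < length ?Xs. ([m, bang U, \<chi> \<cdot> m] ! i) \<cdot> u = fs ! i)"
      if c: "is_cone E ?Xs ?D A fs" for A fs
    proof -
      have A: "A \<in> Ob E" and fs: "\<And>i. i < 3 \<Longrightarrow> fs ! i \<in> hom E A (?Xs ! i)"
        and eq: "\<chi> \<cdot> fs ! 0 = fs ! 2" "tr \<cdot> fs ! 1 = fs ! 2"
        using c by (auto simp: is_cone_def)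
      from fs[of 0] fs[of 1] have f0: "fs ! 0 \<in> hom E A X" and f1: "fs ! 1 \<in> hom E A (Prod E [])"
        by auto
      have f1: "fs ! 1 = bang A" using f1 by (rule bang_eqI) (use A in \<open>simp add: hom_iff\<close>)
      with R f0 eq obtain w where w: "w \<in> hom E A U" "m \<cdot> w = fs ! 0" by metis
      have "\<chi> \<cdot> m \<cdot> w = fs ! 2" using w m \<chi> eq by (simp add: hom_iff)
      moreover have "bang U \<cdot> w = fs ! 1" using w(1) f1 U by (simp add: hom_iff)
      ultimately have "\<forall>i < length ?Xs. ([m, bang U, \<chi> \<cdot> m] ! i) \<cdot> w = fs ! i"
        using w(2) by (auto simp: less_Suc_eq numeral_2_eq_2)
      moreover have "v = w" if "v \<in> hom E A U" "\<forall>i < length ?Xs. ([m, bang U, \<chi> \<cdot> m] ! i) \<cdot> v = fs ! i"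
        for v using that(2)[rule_format, of 0] monoD[OF m(2) _ that(1) w(1) m(1)] w(2) by simp
      ultimately show ?thesis using w(1) by blast
    qed
    ultimately show ?thesis unfolding pb is_limit_def by blast
  qed
qed

end


section \<open>Local state classifiers in a topos\<close>

locale lsc_topos = finlim_category E for E :: "('o, 'm) cat" (structure) +
  fixes Om :: 'o and tr :: 'm and \<Xi> :: 'o and \<xi> :: "'o \<Rightarrow> 'm"
  assumes exponentials: "\<And>Y Z. Y \<in> Ob E \<Longrightarrow> Z \<in> Ob E \<Longrightarrow> \<exists>W ev. is_exponential E Y Z W ev"
    and classifier: "is_subobject_classifier E Om tr"
    and lsc: "local_state_classifier E \<Xi> \<xi>"
begin

section \<open>Subobjects as predicates on generalized elements\<close>

lemma Om_Ob [simp]: "Om \<in> Ob E" and tr_hom: "tr \<in> hom E (Prod E []) Om"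
  using classifier by (auto simp: is_subobject_classifier_def)

lemma classify:
  assumes "m \<in> hom E U X" "is_mono E m"
  obtains \<chi> where "\<chi> \<in> hom E X Om"
    "\<And>T x. x \<in> hom E T X \<Longrightarrow> \<chi> \<cdot> x = tr \<cdot> bang T \<longleftrightarrow> (\<exists>w \<in> hom E T U. m \<cdot> w = x)"
proof -
  from classifier assms obtain \<chi> where "\<chi> \<in> hom E X Om" "is_pullback E U m (bang U) \<chi> tr"
    unfolding is_subobject_classifier_def by blast
  with is_pullback_truth_iff[OF assms this(1) tr_hom] that show thesis by blast
qed

text \<open>The subobject is the pullback of truth along \<chi>; it is monic because its other leg
  ends in the terminal object, where all arrows agree.\<close>

lemma comprehension:
  assumes \<chi>: "\<chi> \<in> hom E X Om"
  obtains U m where "m \<in> hom E U X" "is_mono E m"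
    "\<And>T x. x \<in> hom E T X \<Longrightarrow> \<chi> \<cdot> x = tr \<cdot> bang T \<longleftrightarrow> (\<exists>w \<in> hom E T U. m \<cdot> w = x)"
proof -
  obtain U m q where m: "m \<in> hom E U X" "q \<in> hom E U (Prod E [])" "\<chi> \<cdot> m = tr \<cdot> q"
    and univ: "\<And>T a b. a \<in> hom E T X \<Longrightarrow> b \<in> hom E T (Prod E []) \<Longrightarrow> \<chi> \<cdot> a = tr \<cdot> b \<Longrightarrow>
       \<exists>w \<in> hom E T U. m \<cdot> w = a \<and> q \<cdot> w = b"
    and inj: "\<And>T w w'. w \<in> hom E T U \<Longrightarrow> w' \<in> hom E T U \<Longrightarrow> m \<cdot> w = m \<cdot> w' \<Longrightarrow> q \<cdot> w = q \<cdot> w' \<Longrightarrow> w = w'"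
    by (rule pullback[OF \<chi> tr_hom]) (rule that)
  have mono: "is_mono E m"
  proof (rule monoI[OF m(1)])
    fix A f g assume fg: "f \<in> hom E A U" "g \<in> hom E A U" "m \<cdot> f = m \<cdot> g"
    show "f = g"
      by (rule inj[OF fg]) (rule bang_eqI; use fg m in \<open>auto intro: comp_hom\<close>)
  qed
  have "\<chi> \<cdot> x = tr \<cdot> bang T \<longleftrightarrow> (\<exists>w \<in> hom E T U. m \<cdot> w = x)" if x: "x \<in> hom E T X" for T x
  proof
    assume "\<chi> \<cdot> x = tr \<cdot> bang T"
    with univ[OF x, of "bang T"] x show "\<exists>w \<in> hom E T U. m \<cdot> w = x"
      by (auto simp: hom_iff)
  next
    assume "\<exists>w \<in> hom E T U. m \<cdot> w = x"
    then obtain w where w: "w \<in> hom E T U" "m \<cdot> w = x" by blast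
    have "\<chi> \<cdot> (m \<cdot> w) = tr \<cdot> (q \<cdot> w)"
      by (rule comp_eq_comp) (use w(1) m \<chi> tr_hom in \<open>simp_all add: hom_iff\<close>)
    moreover have "q \<cdot> w = bang T"
      by (rule bang_eqI[of _ T]) (use w(1) m(2) in \<open>auto simp: hom_iff\<close>)
    ultimately show "\<chi> \<cdot> x = tr \<cdot> bang T" using w by simp
  qed
  with m(1) mono show thesis by (rule that)
qed

text \<open>Both maps classify the subobject that \<chi> defines, and classifying maps are
  unique.\<close>

lemma Om_eqI:
  assumes "\<chi> \<in> hom E X Om" "\<chi>' \<in> hom E X Om"
    and "\<And>T x. x \<in> hom E T X \<Longrightarrow> \<chi> \<cdot> x = tr \<cdot> bang T \<longleftrightarrow> \<chi>' \<cdot> x = tr \<cdot> bang T"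
  shows "\<chi> = \<chi>'"
proof -
  obtain U m where m: "m \<in> hom E U X" "is_mono E m"
    and *: "\<And>T x. x \<in> hom E T X \<Longrightarrow> \<chi> \<cdot> x = tr \<cdot> bang T \<longleftrightarrow> (\<exists>w \<in> hom E T U. m \<cdot> w = x)"
    by (rule comprehension[OF assms(1)]) (rule that)
  have "is_pullback E U m (bang U) \<chi> tr" "is_pullback E U m (bang U) \<chi>' tr"
    using is_pullback_truth_iff[OF m assms(1) tr_hom]
      is_pullback_truth_iff[OF m assms(2) tr_hom] * assms(3) by blast+
  with classifier m assms(1,2) show ?thesis
    unfolding is_subobject_classifier_def by blast
qed

text \<open>The characteristic maps of \<open>m\<close> and \<open>n\<close> agree along each
  \<open>c j\<close> by extensionality, hence agree outright. Thus a family that is jointly epic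
  only against \<open>Om\<close> behaves like a cover of \<open>P\<close> for comparing
  subobjects.\<close>

lemma subobject_le:
  assumes m: "m \<in> hom E A P" "is_mono E m" and n: "n \<in> hom E B P" "is_mono E n"
    and c: "\<And>j. j \<in> J \<Longrightarrow> c j \<in> hom E (C j) P"
    and epi: "\<And>u v. u \<in> hom E P Om \<Longrightarrow> v \<in> hom E P Om \<Longrightarrow> (\<And>j. j \<in> J \<Longrightarrow> u \<cdot> c j = v \<cdot> c j) \<Longrightarrow> u = v"
    and eq: "\<And>j T x. j \<in> J \<Longrightarrow> x \<in> hom E T (C j) \<Longrightarrow>
       (\<exists>w \<in> hom E T A. m \<cdot> w = c j \<cdot> x) \<longleftrightarrow> (\<exists>w \<in> hom E T B. n \<cdot> w = c j \<cdot> x)"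
  shows "\<exists>w \<in> hom E A B. n \<cdot> w = m"
proof -
  obtain \<chi> where \<chi>: "\<chi> \<in> hom E P Om"
    "\<And>T x. x \<in> hom E T P \<Longrightarrow> \<chi> \<cdot> x = tr \<cdot> bang T \<longleftrightarrow> (\<exists>w \<in> hom E T A. m \<cdot> w = x)"
    by (rule classify[OF m]) (rule that)
  obtain \<chi>' where \<chi>': "\<chi>' \<in> hom E P Om"
    "\<And>T x. x \<in> hom E T P \<Longrightarrow> \<chi>' \<cdot> x = tr \<cdot> bang T \<longleftrightarrow> (\<exists>w \<in> hom E T B. n \<cdot> w = x)"
    by (rule classify[OF n]) (rule that)
  have "\<chi> = \<chi>'"
  proof (rule epi[OF \<chi>(1) \<chi>'(1)])
    fix j assume j: "j \<in> J"
    show "\<chi> \<cdot> c j = \<chi>' \<cdot> c j"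
    proof (rule Om_eqI[OF comp_hom[OF c[OF j] \<chi>(1)] comp_hom[OF c[OF j] \<chi>'(1)]])
      fix T x assume x: "x \<in> hom E T (C j)"
      have "(\<chi> \<cdot> c j) \<cdot> x = \<chi> \<cdot> (c j \<cdot> x)" "(\<chi>' \<cdot> c j) \<cdot> x = \<chi>' \<cdot> (c j \<cdot> x)"
        using \<chi>(1) \<chi>'(1) x c[OF j] by (simp_all add: hom_iff)
      then show "(\<chi> \<cdot> c j) \<cdot> x = tr \<cdot> bang T \<longleftrightarrow> (\<chi>' \<cdot> c j) \<cdot> x = tr \<cdot> bang T"
        using \<chi>(2)[OF comp_hom[OF x c[OF j]]] \<chi>'(2)[OF comp_hom[OF x c[OF j]]] eq[OF j x] by simp
    qed
  qed
  moreover have "\<exists>w \<in> hom E A A. m \<cdot> w = m"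
    using m(1) by (intro bexI[of _ "Id E A"]) (auto simp: hom_iff)
  ultimately show ?thesis using \<chi>(2)[OF m(1)] \<chi>'(2)[OF m(1)] by simp
qed

section \<open>Exponentials and the colimit \<Xi> with a parameter\<close>

lemma exponential:
  assumes "Y \<in> Ob E" "Z \<in> Ob E"
  obtains W ev where "W \<in> Ob E" "ev \<in> hom E (W \<otimes> Y) Z"
    "\<And>A f. A \<in> Ob E \<Longrightarrow> f \<in> hom E (A \<otimes> Y) Z \<Longrightarrow>
       \<exists>!g. g \<in> hom E A W \<and> ev \<cdot> pair (g \<cdot> p1 A Y) (p2 A Y) = f"
proof -
  from exponentials[OF assms] obtain W ev where
    W: "W \<in> Ob E" "ev \<in> hom E (W \<otimes> Y) Z" and
    ex: "\<And>A f. A \<in> Ob E \<Longrightarrow> f \<in> hom E (A \<otimes> Y) Z \<Longrightarrow>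
        \<exists>!g. g \<in> hom E A W \<and> ev \<cdot> prod_map E [A, Y] [W, Y] [g, Id E Y] = f"
    unfolding is_exponential_def by blast
  have pm: "prod_map E [A, Y] [W, Y] [g, Id E Y] = pair (g \<cdot> p1 A Y) (p2 A Y)"
    if "A \<in> Ob E" "g \<in> hom E A W" for A g
    using that assms W by (simp add: prod_map_def pair_def hom_iff)
  show thesis
  proof (rule that[OF W])
    fix A f assume A: "A \<in> Ob E" "f \<in> hom E (A \<otimes> Y) Z"
    have "(g \<in> hom E A W \<and> ev \<cdot> pair (g \<cdot> p1 A Y) (p2 A Y) = f) \<longleftrightarrow>
        (g \<in> hom E A W \<and> ev \<cdot> prod_map E [A, Y] [W, Y] [g, Id E Y] = f)" for g
      using pm[OF A(1)] by auto
    with ex[OF A] show "\<exists>!g. g \<in> hom E A W \<and> ev \<cdot> pair (g \<cdot> p1 A Y) (p2 A Y) = f" by simp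
  qed
qed

lemma Xi_Ob [simp]: "\<Xi> \<in> Ob E"
  and xi_hom: "X \<in> Ob E \<Longrightarrow> \<xi> X \<in> hom E X \<Xi>"
  and xi_mono: "m \<in> hom E X Y \<Longrightarrow> is_mono E m \<Longrightarrow> \<xi> Y \<cdot> m = \<xi> X"
  using lsc unfolding local_state_classifier_def mono_cocone_def by blast+

lemma xi_typing [simp]:
  assumes "X \<in> Ob E"
  shows "\<xi> X \<in> Arr E" "Dom E (\<xi> X) = X" "Cod E (\<xi> X) = \<Xi>"
  using xi_hom[OF assms] by (auto simp: hom_iff)

lemma xi_mono_comp:
  assumes "m \<in> hom E A B" "is_mono E m" "x \<in> hom E T A"
  shows "\<xi> B \<cdot> (m \<cdot> x) = \<xi> A \<cdot> x"
  using comp_eq[OF xi_mono[OF assms(1,2)], of x] assms by (auto simp: hom_iff)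

text \<open>Transposing turns the \<open>\<theta> X\<close> into arrows to the exponential
  \<open>V\<close> that form a cocone under monomorphisms. The target \<open>W\<close> is kept
  general: it is \<Xi> when the meet is built and \<open>Om\<close> when relations are
  glued.\<close>

lemma lsc_with_parameter:
  assumes Z: "Z \<in> Ob E" and W: "W \<in> Ob E"
    and \<theta>: "\<And>X. X \<in> Ob E \<Longrightarrow> \<theta> X \<in> hom E (X \<otimes> Z) W"
    and compat: "\<And>X Y m. m \<in> hom E X Y \<Longrightarrow> is_mono E m \<Longrightarrow>
      \<theta> Y \<cdot> pair (m \<cdot> p1 X Z) (p2 X Z) = \<theta> X"
  shows "\<exists>!u. u \<in> hom E (\<Xi> \<otimes> Z) W \<and> (\<forall>X \<in> Ob E. u \<cdot> pair (\<xi> X \<cdot> p1 X Z) (p2 X Z) = \<theta> X)"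
proof -
  obtain V ev where V: "V \<in> Ob E" and ev: "ev \<in> hom E (V \<otimes> Z) W" and
    ex: "\<And>A f. A \<in> Ob E \<Longrightarrow> f \<in> hom E (A \<otimes> Z) W \<Longrightarrow>
       \<exists>!g. g \<in> hom E A V \<and> ev \<cdot> pair (g \<cdot> p1 A Z) (p2 A Z) = f"
    by (rule exponential[OF Z W]) (rule that)
  define unc where "unc A g = ev \<cdot> pair (g \<cdot> p1 A Z) (p2 A Z)" for A g
  have unc_hom: "unc A g \<in> hom E (A \<otimes> Z) W" if "g \<in> hom E A V" for A g
    using that ev Z V by (auto simp: unc_def hom_iff)
  have unc_inj: "g = g'" if "g \<in> hom E A V" "g' \<in> hom E A V" "unc A g = unc A g'" for A g g'
  proof -
    have "A \<in> Ob E" using that by (auto simp: hom_iff)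
    from ex[OF this unc_hom[OF that(1)]] that show ?thesis unfolding unc_def by metis
  qed
  have unc_comp: "unc B g \<cdot> pair (h \<cdot> p1 A Z) (p2 A Z) = unc A (g \<cdot> h)"
    if "g \<in> hom E B V" "h \<in> hom E A B" for A B g h
    using that ev Z V by (auto simp: unc_def hom_iff)
  have "\<forall>X \<in> Ob E. \<exists>g. g \<in> hom E X V \<and> unc X g = \<theta> X"
    using ex[OF _ \<theta>] unfolding unc_def by blast
  then obtain \<phi> where \<phi>: "\<And>X. X \<in> Ob E \<Longrightarrow> \<phi> X \<in> hom E X V \<and> unc X (\<phi> X) = \<theta> X"
    by metis
  have cocone: "mono_cocone E V \<phi>"
    unfolding mono_cocone_def
  proof (intro conjI allI impI ballI)
    show "V \<in> Ob E" by (rule V)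
    show "\<phi> X \<in> hom E X V" if "X \<in> Ob E" for X using \<phi> that by blast
    fix X Y m assume m: "m \<in> hom E X Y" "is_mono E m"
    then have ob: "X \<in> Ob E" "Y \<in> Ob E" by (auto simp: hom_iff)
    show "\<phi> Y \<cdot> m = \<phi> X"
    proof (rule unc_inj)
      show "unc X (\<phi> Y \<cdot> m) = unc X (\<phi> X)"
        using unc_comp[of "\<phi> Y" Y m X] \<phi>[OF ob(1)] \<phi>[OF ob(2)] m compat by simp
    qed (use \<phi> ob m comp_hom in blast)+
  qed
  \<comment> \<open>Uncurrying is natural and injective, so the condition on arrows out of
    \<open>\<Xi> \<otimes> Z\<close> and the condition on their transposes single out the same
    arrow.\<close>
  have iff: "(unc \<Xi> g \<cdot> pair (\<xi> X \<cdot> p1 X Z) (p2 X Z) = \<theta> X) \<longleftrightarrow> g \<cdot> \<xi> X = \<phi> X"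
    if g: "g \<in> hom E \<Xi> V" and X: "X \<in> Ob E" for g X
    unfolding unc_comp[OF g xi_hom[OF X]]
    using \<phi>[OF X] unc_inj[OF comp_hom[OF xi_hom[OF X] g], of "\<phi> X"] by metis
  from lsc cocone obtain u where u: "u \<in> hom E \<Xi> V" "\<And>X. X \<in> Ob E \<Longrightarrow> u \<cdot> \<xi> X = \<phi> X"
    and uniq: "\<And>v. v \<in> hom E \<Xi> V \<Longrightarrow> (\<And>X. X \<in> Ob E \<Longrightarrow> v \<cdot> \<xi> X = \<phi> X) \<Longrightarrow> v = u"
    unfolding local_state_classifier_def by metis
  show ?thesis
  proof (rule ex1I[of _ "unc \<Xi> u"], intro conjI ballI)
    show "unc \<Xi> u \<in> hom E (\<Xi> \<otimes> Z) W" using unc_hom u(1) .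
    show "unc \<Xi> u \<cdot> pair (\<xi> X \<cdot> p1 X Z) (p2 X Z) = \<theta> X" if "X \<in> Ob E" for X
      using iff[OF u(1) that] u(2)[OF that] by simp
    fix v assume v: "v \<in> hom E (\<Xi> \<otimes> Z) W \<and> (\<forall>X \<in> Ob E. v \<cdot> pair (\<xi> X \<cdot> p1 X Z) (p2 X Z) = \<theta> X)"
    then obtain g where g: "g \<in> hom E \<Xi> V" "unc \<Xi> g = v"
      using ex[of \<Xi> v] unfolding unc_def by auto
    with v iff[OF g(1)] have "g = u" by (intro uniq) auto
    with g show "v = unc \<Xi> u" by simp
  qed
qed

text \<open>The family obtained by restricting \<open>u\<close> is itself compatible with
  monomorphisms, because \<open>\<xi>\<close> is; both \<open>u\<close> and \<open>v\<close> are
  then the arrow that it induces.\<close>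

lemma lsc_param_eqI:
  assumes Z: "Z \<in> Ob E" and u: "u \<in> hom E (\<Xi> \<otimes> Z) W" and v: "v \<in> hom E (\<Xi> \<otimes> Z) W"
    and eq: "\<And>X. X \<in> Ob E \<Longrightarrow>
      u \<cdot> pair (\<xi> X \<cdot> p1 X Z) (p2 X Z) = v \<cdot> pair (\<xi> X \<cdot> p1 X Z) (p2 X Z)"
  shows "u = v"
proof -
  let ?\<theta> = "\<lambda>X. u \<cdot> pair (\<xi> X \<cdot> p1 X Z) (p2 X Z)"
  have W: "W \<in> Ob E" using u by (auto simp: hom_iff)
  have "\<exists>!u. u \<in> hom E (\<Xi> \<otimes> Z) W \<and> (\<forall>X \<in> Ob E. u \<cdot> pair (\<xi> X \<cdot> p1 X Z) (p2 X Z) = ?\<theta> X)"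
  proof (rule lsc_with_parameter[OF Z W])
    show "?\<theta> X \<in> hom E (X \<otimes> Z) W" if "X \<in> Ob E" for X
      using that u Z by (auto simp: hom_iff)
    fix X Y m assume m: "m \<in> hom E X Y" "is_mono E m"
    then have "\<xi> Y \<cdot> (m \<cdot> p1 X Z) = \<xi> X \<cdot> p1 X Z"
      by (intro xi_mono_comp[of _ _ _ _ "X \<otimes> Z"]) (use m Z in \<open>auto simp: hom_iff\<close>)
    then show "?\<theta> Y \<cdot> pair (m \<cdot> p1 X Z) (p2 X Z) = ?\<theta> X"
      using m(1) u Z by (auto simp: hom_iff)
  qed
  then show ?thesis using u v eq by metis
qed

text \<open>An identity between natural operations on generalized elements of \<open>\<Xi>\<close> may be checked on
  the elements \<open>\<xi> X \<cdot> x\<close>; the second argument of \<open>N\<close> carries the change of stage along which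
  other parameters are restricted.\<close>

lemma lsc_natural_eqI:
  assumes f: "f \<in> hom E T \<Xi>"
    and N: "\<And>S f h. f \<in> hom E S \<Xi> \<Longrightarrow> h \<in> hom E S T \<Longrightarrow> N f h \<in> hom E S W"
      "\<And>S S' f h k. f \<in> hom E S \<Xi> \<Longrightarrow> h \<in> hom E S T \<Longrightarrow> k \<in> hom E S' S \<Longrightarrow>
         N f h \<cdot> k = N (f \<cdot> k) (h \<cdot> k)"
    and N': "\<And>S f h. f \<in> hom E S \<Xi> \<Longrightarrow> h \<in> hom E S T \<Longrightarrow> N' f h \<in> hom E S W"
      "\<And>S S' f h k. f \<in> hom E S \<Xi> \<Longrightarrow> h \<in> hom E S T \<Longrightarrow> k \<in> hom E S' S \<Longrightarrow>
         N' f h \<cdot> k = N' (f \<cdot> k) (h \<cdot> k)"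
    and eq: "\<And>S X x h. X \<in> Ob E \<Longrightarrow> x \<in> hom E S X \<Longrightarrow> h \<in> hom E S T \<Longrightarrow>
         N (\<xi> X \<cdot> x) h = N' (\<xi> X \<cdot> x) h"
  shows "N f (Id E T) = N' f (Id E T)"
proof -
  have T: "T \<in> Ob E" using f by (auto simp: hom_iff)
  let ?p = "p1 \<Xi> T" and ?q = "p2 \<Xi> T"
  have p: "?p \<in> hom E (\<Xi> \<otimes> T) \<Xi>" and q: "?q \<in> hom E (\<Xi> \<otimes> T) T" using T by (auto simp: hom_iff)
  \<comment> \<open>The projections are the generic pair of an element of \<Xi> and a change of
    stage; the given \<open>f\<close> with the identity arises from them by restriction along
    \<open>pair f (Id E T)\<close>.\<close>
  have *: "N ?p ?q = N' ?p ?q"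
  proof (rule lsc_param_eqI[OF T N(1)[OF p q] N'(1)[OF p q]])
    fix X assume X: "X \<in> Ob E"
    let ?k = "pair (\<xi> X \<cdot> p1 X T) (p2 X T)"
    have k: "?k \<in> hom E (X \<otimes> T) (\<Xi> \<otimes> T)" using X T by (auto simp: hom_iff)
    have "?p \<cdot> ?k = \<xi> X \<cdot> p1 X T" "?q \<cdot> ?k = p2 X T" using X T by auto
    then show "N ?p ?q \<cdot> ?k = N' ?p ?q \<cdot> ?k"
      using N(2)[OF p q k] N'(2)[OF p q k] eq[OF X, of "p1 X T" "X \<otimes> T" "p2 X T"] X T
      by (auto simp: hom_iff)
  qed
  let ?k = "pair f (Id E T)"
  have k: "?k \<in> hom E T (\<Xi> \<otimes> T)" using f T by (auto simp: hom_iff)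
  have "?p \<cdot> ?k = f" "?q \<cdot> ?k = Id E T" using f T by (auto simp: hom_iff)
  then show ?thesis using N(2)[OF p q k] N'(2)[OF p q k] * by simp
qed

text \<open>The one-variable principle is used twice: for \<open>f\<close>, with \<open>g\<close>
  restricted along the change of stage, and then for the restricted \<open>g\<close>, with the
  element \<open>x\<close> restricted in turn. Identities such as \<open>g \<cdot> Id E T\<close>
  are inserted to exhibit the place where the change of stage acts.\<close>

lemma lsc_natural_eqI2:
  assumes f: "f \<in> hom E T \<Xi>" and g: "g \<in> hom E T \<Xi>"
    and N: "\<And>S f g h. f \<in> hom E S \<Xi> \<Longrightarrow> g \<in> hom E S \<Xi> \<Longrightarrow> h \<in> hom E S T \<Longrightarrow> N f g h \<in> hom E S W"
      "\<And>S S' f g h k. f \<in> hom E S \<Xi> \<Longrightarrow> g \<in> hom E S \<Xi> \<Longrightarrow> h \<in> hom E S T \<Longrightarrow> k \<in> hom E S' S \<Longrightarrow>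
         N f g h \<cdot> k = N (f \<cdot> k) (g \<cdot> k) (h \<cdot> k)"
    and N': "\<And>S f g h. f \<in> hom E S \<Xi> \<Longrightarrow> g \<in> hom E S \<Xi> \<Longrightarrow> h \<in> hom E S T \<Longrightarrow> N' f g h \<in> hom E S W"
      "\<And>S S' f g h k. f \<in> hom E S \<Xi> \<Longrightarrow> g \<in> hom E S \<Xi> \<Longrightarrow> h \<in> hom E S T \<Longrightarrow> k \<in> hom E S' S \<Longrightarrow>
         N' f g h \<cdot> k = N' (f \<cdot> k) (g \<cdot> k) (h \<cdot> k)"
    and eq: "\<And>S X Y x y h. X \<in> Ob E \<Longrightarrow> Y \<in> Ob E \<Longrightarrow> x \<in> hom E S X \<Longrightarrow> y \<in> hom E S Y \<Longrightarrow> h \<in> hom E S T \<Longrightarrow>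
         N (\<xi> X \<cdot> x) (\<xi> Y \<cdot> y) h = N' (\<xi> X \<cdot> x) (\<xi> Y \<cdot> y) h"
  shows "N f g (Id E T) = N' f g (Id E T)"
proof -
  have assoc: "(a \<cdot> b) \<cdot> c = a \<cdot> (b \<cdot> c)" if "a \<in> hom E B C" "b \<in> hom E D B" "c \<in> hom E G D"
    for a b c B C D G using that by (simp add: hom_iff)
  have "N f (g \<cdot> Id E T) (Id E T) = N' f (g \<cdot> Id E T) (Id E T)"
  proof (rule lsc_natural_eqI[of f T "\<lambda>f h. N f (g \<cdot> h) h" W "\<lambda>f h. N' f (g \<cdot> h) h"])
    fix S X x h assume X: "X \<in> Ob E" and x: "x \<in> hom E S X" and h: "h \<in> hom E S T"
    have S: "S \<in> Ob E" using x by (auto simp: hom_iff)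
    have xk: "\<xi> X \<cdot> (x \<cdot> k) \<in> hom E R \<Xi>" if "k \<in> hom E R S" for k R
      using that x X by (simp add: hom_iff)
    have "N (\<xi> X \<cdot> (x \<cdot> Id E S)) (g \<cdot> h) (h \<cdot> Id E S) = N' (\<xi> X \<cdot> (x \<cdot> Id E S)) (g \<cdot> h) (h \<cdot> Id E S)"
    proof (rule lsc_natural_eqI[of "g \<cdot> h" S "\<lambda>g k. N (\<xi> X \<cdot> (x \<cdot> k)) g (h \<cdot> k)" W
          "\<lambda>g k. N' (\<xi> X \<cdot> (x \<cdot> k)) g (h \<cdot> k)"])
      show "g \<cdot> h \<in> hom E S \<Xi>" using comp_hom[OF h g] .
      fix R l k assume l: "l \<in> hom E R \<Xi>" and k: "k \<in> hom E R S"
      note hk = comp_hom[OF k h]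
      show "N (\<xi> X \<cdot> (x \<cdot> k)) l (h \<cdot> k) \<in> hom E R W" "N' (\<xi> X \<cdot> (x \<cdot> k)) l (h \<cdot> k) \<in> hom E R W"
        using N(1)[OF xk[OF k] l hk] N'(1)[OF xk[OF k] l hk] .
      fix R' j assume j: "j \<in> hom E R' R"
      have "(\<xi> X \<cdot> (x \<cdot> k)) \<cdot> j = \<xi> X \<cdot> (x \<cdot> (k \<cdot> j))" "(h \<cdot> k) \<cdot> j = h \<cdot> (k \<cdot> j)"
        using X x k j h by (simp_all add: hom_iff)
      then show "N (\<xi> X \<cdot> (x \<cdot> k)) l (h \<cdot> k) \<cdot> j = N (\<xi> X \<cdot> (x \<cdot> (k \<cdot> j))) (l \<cdot> j) (h \<cdot> (k \<cdot> j))"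
        "N' (\<xi> X \<cdot> (x \<cdot> k)) l (h \<cdot> k) \<cdot> j = N' (\<xi> X \<cdot> (x \<cdot> (k \<cdot> j))) (l \<cdot> j) (h \<cdot> (k \<cdot> j))"
        using N(2)[OF xk[OF k] l hk j] N'(2)[OF xk[OF k] l hk j] by simp_all
    next
      fix R Y y k assume "Y \<in> Ob E" "y \<in> hom E R Y" "k \<in> hom E R S"
      then show "N (\<xi> X \<cdot> (x \<cdot> k)) (\<xi> Y \<cdot> y) (h \<cdot> k) = N' (\<xi> X \<cdot> (x \<cdot> k)) (\<xi> Y \<cdot> y) (h \<cdot> k)"
        using X x h by (intro eq comp_hom)
    qed
    then show "N (\<xi> X \<cdot> x) (g \<cdot> h) h = N' (\<xi> X \<cdot> x) (g \<cdot> h) h"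
      using x h by (simp add: hom_iff)
  next
    fix S f h assume f: "f \<in> hom E S \<Xi>" and h: "h \<in> hom E S T"
    note gh = comp_hom[OF h g]
    show "N f (g \<cdot> h) h \<in> hom E S W" "N' f (g \<cdot> h) h \<in> hom E S W"
      using N(1)[OF f gh h] N'(1)[OF f gh h] .
    fix S' k assume k: "k \<in> hom E S' S"
    show "N f (g \<cdot> h) h \<cdot> k = N (f \<cdot> k) (g \<cdot> (h \<cdot> k)) (h \<cdot> k)"
      "N' f (g \<cdot> h) h \<cdot> k = N' (f \<cdot> k) (g \<cdot> (h \<cdot> k)) (h \<cdot> k)"
      using N(2)[OF f gh h k] N'(2)[OF f gh h k] assoc[OF g h k] by simp_all
  qed (rule f)
  then show ?thesis using g by (simp add: hom_iff)
qed

section \<open>The binary meet on \<Xi>\<close>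

text \<open>Only the binary instance of the condition on meets is recorded. It determines \<mu>, and
  the semilattice laws and the condition for all arities are derived from it.\<close>

definition lsc_mult :: "'m \<Rightarrow> bool" where
  "lsc_mult \<mu> \<longleftrightarrow> \<mu> \<in> hom E (\<Xi> \<otimes> \<Xi>) \<Xi> \<and>
     (\<forall>X \<in> Ob E. \<forall>Y \<in> Ob E. \<mu> \<cdot> pair (\<xi> X \<cdot> p1 X Y) (\<xi> Y \<cdot> p2 X Y) = \<xi> (X \<otimes> Y))"

lemma lsc_mult_typing:
  assumes "lsc_mult \<mu>"
  shows "\<mu> \<in> Arr E" "Dom E \<mu> = \<Xi> \<otimes> \<Xi>" "Cod E \<mu> = \<Xi>"
  using assms by (auto simp: lsc_mult_def hom_iff)

text \<open>The defining equation at the element \<open>pair x y\<close>. In this form \<mu> can be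
  computed on all the elements that the naturality principles leave to check.\<close>

lemma lsc_mult_xi:
  assumes \<mu>: "lsc_mult \<mu>" and x: "x \<in> hom E T X" and y: "y \<in> hom E T Y"
  shows "\<mu> \<cdot> pair (\<xi> X \<cdot> x) (\<xi> Y \<cdot> y) = \<xi> (X \<otimes> Y) \<cdot> pair x y"
proof -
  have ob: "X \<in> Ob E" "Y \<in> Ob E" using x y by (auto simp: hom_iff)
  then have "\<mu> \<cdot> pair (\<xi> X \<cdot> p1 X Y) (\<xi> Y \<cdot> p2 X Y) = \<xi> (X \<otimes> Y)" using \<mu> by (simp add: lsc_mult_def)
  then have "\<mu> \<cdot> (pair (\<xi> X \<cdot> p1 X Y) (\<xi> Y \<cdot> p2 X Y) \<cdot> pair x y) = \<xi> (X \<otimes> Y) \<cdot> pair x y"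
    by (rule comp_eq) (use x y ob lsc_mult_typing[OF \<mu>] in \<open>simp_all add: hom_iff\<close>)
  then show ?thesis using x y ob by (simp add: hom_iff)
qed

lemma lsc_mult_unique:
  assumes \<mu>: "lsc_mult \<mu>" and \<nu>: "lsc_mult \<nu>"
  shows "\<mu> = \<nu>"
proof -
  note [simp] = lsc_mult_typing[OF \<mu>] lsc_mult_typing[OF \<nu>]
  have "\<mu> \<cdot> pair (p1 \<Xi> \<Xi>) (p2 \<Xi> \<Xi>) = \<nu> \<cdot> pair (p1 \<Xi> \<Xi>) (p2 \<Xi> \<Xi>)"
    by (rule lsc_natural_eqI2[of _ "\<Xi> \<otimes> \<Xi>" _ "\<lambda>f g h. \<mu> \<cdot> pair f g" \<Xi> "\<lambda>f g h. \<nu> \<cdot> pair f g"])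
      (auto simp: hom_iff lsc_mult_xi[OF \<mu>] lsc_mult_xi[OF \<nu>])
  then show ?thesis by simp
qed

text \<open>Currying turns the universal property of \<open>\<Xi>\<close> into one of \<open>\<Xi> \<otimes> Y\<close>, and a second
  application into one of \<open>\<Xi> \<otimes> \<Xi>\<close>.\<close>

lemma lsc_mult_exists: "\<exists>\<mu>. lsc_mult \<mu>"
proof -
  \<comment> \<open>For fixed \<open>Y\<close> the family \<open>\<xi> (X \<otimes> Y)\<close> is
    compatible in \<open>X\<close>, because the product of a monomorphism with the identity of
    \<open>Y\<close> is monic.\<close>
  have "\<exists>u. u \<in> hom E (\<Xi> \<otimes> Y) \<Xi> \<and>
      (\<forall>X \<in> Ob E. u \<cdot> pair (\<xi> X \<cdot> p1 X Y) (p2 X Y) = \<xi> (X \<otimes> Y))" if Y: "Y \<in> Ob E" for Y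
  proof (rule ex1_implies_ex[OF lsc_with_parameter])
    fix X X' m assume m: "m \<in> hom E X X'" "is_mono E m"
    show "\<xi> (X' \<otimes> Y) \<cdot> pair (m \<cdot> p1 X Y) (p2 X Y) = \<xi> (X \<otimes> Y)"
    proof (rule xi_mono)
      show "is_mono E (pair (m \<cdot> p1 X Y) (p2 X Y))"
        using product_mono[OF m Id_hom[OF Y] Id_mono[OF Y]] Y m(1) by (auto simp: hom_iff)
    qed (use m Y in \<open>auto simp: hom_iff\<close>)
  qed (use Y in \<open>auto intro: xi_hom\<close>)
  then obtain u where u: "\<And>Y. Y \<in> Ob E \<Longrightarrow> u Y \<in> hom E (\<Xi> \<otimes> Y) \<Xi>" and
    u_xi: "\<And>X Y. Y \<in> Ob E \<Longrightarrow> X \<in> Ob E \<Longrightarrow> u Y \<cdot> pair (\<xi> X \<cdot> p1 X Y) (p2 X Y) = \<xi> (X \<otimes> Y)"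
    by metis
  have [simp]: "u Y \<in> Arr E" "Dom E (u Y) = \<Xi> \<otimes> Y" "Cod E (u Y) = \<Xi>" if "Y \<in> Ob E" for Y
    using u[OF that] by (auto simp: hom_iff)
  have u_elem: "u Y \<cdot> pair (\<xi> X \<cdot> x) y = \<xi> (X \<otimes> Y) \<cdot> pair x y"
    if x: "x \<in> hom E T X" and y: "y \<in> hom E T Y" for X Y T x y
  proof -
    have ob: "X \<in> Ob E" "Y \<in> Ob E" using x y by (auto simp: hom_iff)
    have "u Y \<cdot> (pair (\<xi> X \<cdot> p1 X Y) (p2 X Y) \<cdot> pair x y) = \<xi> (X \<otimes> Y) \<cdot> pair x y"
      by (rule comp_eq[OF u_xi]) (use x y ob in \<open>simp_all add: hom_iff\<close>)
    then show ?thesis using x y ob by (simp add: hom_iff)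
  qed
  \<comment> \<open>Gluing acts on the first factor, so \<open>u Y\<close> is precomposed with the
    swap before \<open>Y\<close> is glued; the swap is undone in the witness for
    \<open>lsc_mult\<close>.\<close>
  have "\<exists>v. v \<in> hom E (\<Xi> \<otimes> \<Xi>) \<Xi> \<and>
      (\<forall>Y \<in> Ob E. v \<cdot> pair (\<xi> Y \<cdot> p1 Y \<Xi>) (p2 Y \<Xi>) = u Y \<cdot> pair (p2 Y \<Xi>) (p1 Y \<Xi>))"
  proof (rule ex1_implies_ex[OF lsc_with_parameter])
    fix Y Y' m assume m: "m \<in> hom E Y Y'" "is_mono E m"
    then have ob: "Y \<in> Ob E" "Y' \<in> Ob E" by (auto simp: hom_iff)
    \<comment> \<open>The coordinate \<open>p2 Y \<Xi>\<close> is an arbitrary element of \<Xi>.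
      Naturality reduces it to \<open>\<xi> X \<cdot> x\<close>, where both sides are values of
      \<open>\<xi>\<close> related by the monomorphism \<open>?n\<close>, the product of the
      identity of \<open>X\<close> with \<open>m\<close>.\<close>
    have "u Y' \<cdot> pair (p2 Y \<Xi>) (m \<cdot> (p1 Y \<Xi> \<cdot> Id E (Y \<otimes> \<Xi>)))
        = u Y \<cdot> pair (p2 Y \<Xi>) (p1 Y \<Xi> \<cdot> Id E (Y \<otimes> \<Xi>))"
    proof (rule lsc_natural_eqI[of _ "Y \<otimes> \<Xi>" "\<lambda>f h. u Y' \<cdot> pair f (m \<cdot> (p1 Y \<Xi> \<cdot> h))" \<Xi>
          "\<lambda>f h. u Y \<cdot> pair f (p1 Y \<Xi> \<cdot> h)"])
      fix S X x h assume X: "X \<in> Ob E" and x: "x \<in> hom E S X" and h: "h \<in> hom E S (Y \<otimes> \<Xi>)"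
      let ?y = "p1 Y \<Xi> \<cdot> h" and ?n = "pair (p1 X Y) (m \<cdot> p2 X Y)"
      have y: "?y \<in> hom E S Y" using h ob by (auto simp: hom_iff)
      have n: "?n \<in> hom E (X \<otimes> Y) (X \<otimes> Y')" using X ob m by (auto simp: hom_iff)
      have mono: "is_mono E ?n"
        using product_mono[OF Id_hom[OF X] Id_mono[OF X] m] X ob by simp
      have "u Y' \<cdot> pair (\<xi> X \<cdot> x) (m \<cdot> ?y) = \<xi> (X \<otimes> Y') \<cdot> (?n \<cdot> pair x ?y)"
        using u_elem[OF x comp_hom[OF y m(1)]] x y m X ob by (simp add: hom_iff)
      also have "\<dots> = \<xi> (X \<otimes> Y) \<cdot> pair x ?y"
        by (rule xi_mono_comp[OF n mono, of _ S]) (use x y in \<open>simp add: hom_iff\<close>)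
      finally show "u Y' \<cdot> pair (\<xi> X \<cdot> x) (m \<cdot> ?y) = u Y \<cdot> pair (\<xi> X \<cdot> x) ?y"
        using u_elem[OF x y] by simp
    qed (use m ob in \<open>auto simp: hom_iff\<close>)
    then show "(u Y' \<cdot> pair (p2 Y' \<Xi>) (p1 Y' \<Xi>)) \<cdot> pair (m \<cdot> p1 Y \<Xi>) (p2 Y \<Xi>)
        = u Y \<cdot> pair (p2 Y \<Xi>) (p1 Y \<Xi>)"
      using m ob by (simp add: hom_iff)
  qed (auto simp: hom_iff)
  then obtain v where v: "v \<in> hom E (\<Xi> \<otimes> \<Xi>) \<Xi>"
    and v_xi: "\<And>Y. Y \<in> Ob E \<Longrightarrow> v \<cdot> pair (\<xi> Y \<cdot> p1 Y \<Xi>) (p2 Y \<Xi>) = u Y \<cdot> pair (p2 Y \<Xi>) (p1 Y \<Xi>)"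
    by blast
  have "lsc_mult (v \<cdot> pair (p2 \<Xi> \<Xi>) (p1 \<Xi> \<Xi>))"
    unfolding lsc_mult_def
  proof (intro conjI ballI)
    show "v \<cdot> pair (p2 \<Xi> \<Xi>) (p1 \<Xi> \<Xi>) \<in> hom E (\<Xi> \<otimes> \<Xi>) \<Xi>" using v by (auto simp: hom_iff)
    fix X Y assume ob: "X \<in> Ob E" "Y \<in> Ob E"
    let ?x = "p1 X Y" and ?y = "p2 X Y"
    have "v \<cdot> (pair (\<xi> Y \<cdot> p1 Y \<Xi>) (p2 Y \<Xi>) \<cdot> pair ?y (\<xi> X \<cdot> ?x))
        = (u Y \<cdot> pair (p2 Y \<Xi>) (p1 Y \<Xi>)) \<cdot> pair ?y (\<xi> X \<cdot> ?x)"
      by (rule comp_eq[OF v_xi]) (use ob v in \<open>simp_all add: hom_iff\<close>)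
    then have "v \<cdot> pair (\<xi> Y \<cdot> ?y) (\<xi> X \<cdot> ?x) = u Y \<cdot> pair (\<xi> X \<cdot> ?x) ?y"
      using ob by simp
    also have "\<dots> = \<xi> (X \<otimes> Y)"
      using u_xi[OF ob(2,1)] .
    finally show "(v \<cdot> pair (p2 \<Xi> \<Xi>) (p1 \<Xi> \<Xi>)) \<cdot> pair (\<xi> X \<cdot> ?x) (\<xi> Y \<cdot> ?y) = \<xi> (X \<otimes> Y)"
      using ob v by (simp add: hom_iff)
  qed
  then show ?thesis by blast
qed

lemma hom_meet_eq:
  "f \<in> hom E X \<Xi> \<Longrightarrow> g \<in> hom E X \<Xi> \<Longrightarrow> hom_meet E \<Xi> \<mu> X f g = \<mu> \<cdot> pair f g"
  by (simp add: hom_meet_def pair_def hom_iff)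

lemma graph_mono:
  assumes "f \<in> hom E X Y"
  shows "is_mono E (pair (Id E X) f)" "pair (Id E X) f \<in> hom E X (X \<otimes> Y)"
proof -
  show h: "pair (Id E X) f \<in> hom E X (X \<otimes> Y)" using assms by (auto simp: hom_iff)
  show "is_mono E (pair (Id E X) f)"
    by (rule split_mono[OF h, of "p1 X Y"]) (use assms in \<open>auto simp: hom_iff\<close>)
qed

text \<open>The graph of \<open>f\<close> is a monomorphism \<open>X \<rightarrow> X \<otimes> Y\<close>, so \<open>\<xi>\<close> can only increase along \<open>f\<close>.\<close>

lemma lsc_mult_graph:
  assumes \<mu>: "lsc_mult \<mu>" and f: "f \<in> hom E X Y" and x: "x \<in> hom E T X"
  shows "\<mu> \<cdot> pair (\<xi> X \<cdot> x) (\<xi> Y \<cdot> (f \<cdot> x)) = \<xi> X \<cdot> x"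
proof -
  have "\<mu> \<cdot> pair (\<xi> X \<cdot> x) (\<xi> Y \<cdot> (f \<cdot> x)) = \<xi> (X \<otimes> Y) \<cdot> (pair (Id E X) f \<cdot> x)"
    using lsc_mult_xi[OF \<mu> x comp_hom[OF x f]] f x by (auto simp: hom_iff)
  also have "\<dots> = \<xi> X \<cdot> x"
    by (rule xi_mono_comp[OF graph_mono(2,1)[OF f] x])
  finally show ?thesis .
qed

text \<open>The diagonal is the graph of the identity.\<close>

lemma lsc_mult_idem:
  assumes \<mu>: "lsc_mult \<mu>" and f: "f \<in> hom E T \<Xi>"
  shows "\<mu> \<cdot> pair f f = f"
proof (rule lsc_natural_eqI[OF f, of "\<lambda>f h. \<mu> \<cdot> pair f f" \<Xi> "\<lambda>f h. f"])
  fix S X x h assume X: "X \<in> Ob E" and x: "x \<in> hom E S X"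
  show "\<mu> \<cdot> pair (\<xi> X \<cdot> x) (\<xi> X \<cdot> x) = \<xi> X \<cdot> x"
    using lsc_mult_graph[OF \<mu> Id_hom[OF X] x] x by (simp add: hom_iff)
qed (use lsc_mult_typing[OF \<mu>] in \<open>simp_all add: hom_iff\<close>)

text \<open>At \<open>\<xi> X\<close> this is the graph inequality for the arrow
  \<open>\<xi> X\<close> itself.\<close>

lemma lsc_mult_increasing:
  assumes \<mu>: "lsc_mult \<mu>" and f: "f \<in> hom E T \<Xi>"
  shows "\<mu> \<cdot> pair f (\<xi> \<Xi> \<cdot> f) = f"
proof (rule lsc_natural_eqI[OF f, of "\<lambda>f h. \<mu> \<cdot> pair f (\<xi> \<Xi> \<cdot> f)" \<Xi> "\<lambda>f h. f"])
  fix S X x h assume X: "X \<in> Ob E" and x: "x \<in> hom E S X"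
  show "\<mu> \<cdot> pair (\<xi> X \<cdot> x) (\<xi> \<Xi> \<cdot> (\<xi> X \<cdot> x)) = \<xi> X \<cdot> x"
    by (rule lsc_mult_graph[OF \<mu> xi_hom[OF X] x])
qed (use lsc_mult_typing[OF \<mu>] in \<open>simp_all add: hom_iff\<close>)

text \<open>The graph inequality for the arrow to the terminal object puts
  \<open>\<xi> (Prod E [])\<close> above every \<open>\<xi> X\<close>.\<close>

lemma lsc_mult_top:
  assumes \<mu>: "lsc_mult \<mu>" and f: "f \<in> hom E T \<Xi>"
  shows "\<mu> \<cdot> pair f (\<xi> (Prod E []) \<cdot> bang T) = f"
proof -
  have T: "T \<in> Ob E" using f by (auto simp: hom_iff)
  \<comment> \<open>The stage is written \<open>Dom E f\<close> because the operation must make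
    sense at every stage, not only at \<open>T\<close>.\<close>
  have "\<mu> \<cdot> pair f (\<xi> (Prod E []) \<cdot> bang (Dom E f)) = f"
  proof (rule lsc_natural_eqI[OF f, of "\<lambda>f h. \<mu> \<cdot> pair f (\<xi> (Prod E []) \<cdot> bang (Dom E f))" \<Xi> "\<lambda>f h. f"])
    fix S X x h assume X: "X \<in> Ob E" and x: "x \<in> hom E S X"
    have b: "bang X \<in> hom E X (Prod E [])" using X by (simp add: hom_iff)
    show "\<mu> \<cdot> pair (\<xi> X \<cdot> x) (\<xi> (Prod E []) \<cdot> bang (Dom E (\<xi> X \<cdot> x))) = \<xi> X \<cdot> x"
      using lsc_mult_graph[OF \<mu> b x] X x by (simp add: hom_iff)
  qed (use lsc_mult_typing[OF \<mu>] in \<open>simp_all add: hom_iff\<close>)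
  then show ?thesis using f by (simp add: hom_iff)
qed

text \<open>The symmetry of the product is an isomorphism, in particular monic, and
  \<open>\<xi>\<close> is invariant under it.\<close>

lemma lsc_mult_commute:
  assumes \<mu>: "lsc_mult \<mu>" and f: "f \<in> hom E T \<Xi>" and g: "g \<in> hom E T \<Xi>"
  shows "\<mu> \<cdot> pair f g = \<mu> \<cdot> pair g f"
proof (rule lsc_natural_eqI2[OF f g, of "\<lambda>f g h. \<mu> \<cdot> pair f g" \<Xi> "\<lambda>f g h. \<mu> \<cdot> pair g f"])
  fix S X Y x y h assume X: "X \<in> Ob E" and Y: "Y \<in> Ob E" and x: "x \<in> hom E S X" and y: "y \<in> hom E S Y"
  let ?m = "pair (p2 X Y) (p1 X Y)"
  have m: "?m \<in> hom E (X \<otimes> Y) (Y \<otimes> X)" using X Y by (simp add: hom_iff)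
  have mono: "is_mono E ?m"
    by (rule split_mono[OF m, of "pair (p2 Y X) (p1 Y X)"]) (use X Y in \<open>simp_all add: hom_iff\<close>)
  have xy: "pair x y \<in> hom E S (X \<otimes> Y)" using x y by (simp add: hom_iff)
  have "\<xi> (X \<otimes> Y) \<cdot> pair x y = \<xi> (Y \<otimes> X) \<cdot> (?m \<cdot> pair x y)"
    by (rule xi_mono_comp[OF m mono xy, symmetric])
  also have "?m \<cdot> pair x y = pair y x" using X Y x y by (simp add: hom_iff)
  finally show "\<mu> \<cdot> pair (\<xi> X \<cdot> x) (\<xi> Y \<cdot> y) = \<mu> \<cdot> pair (\<xi> Y \<cdot> y) (\<xi> X \<cdot> x)"
    using lsc_mult_xi[OF \<mu> x y] lsc_mult_xi[OF \<mu> y x] by simp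
qed (use lsc_mult_typing[OF \<mu>] in \<open>simp_all add: hom_iff\<close>)

text \<open>The associativity isomorphism of products is monic. The three variables are treated by
  the one-variable principle for \<open>f\<close>, followed by the two-variable principle for
  \<open>g\<close> and \<open>k\<close>.\<close>

lemma lsc_mult_assoc:
  assumes \<mu>: "lsc_mult \<mu>" and f: "f \<in> hom E T \<Xi>" and g: "g \<in> hom E T \<Xi>" and k: "k \<in> hom E T \<Xi>"
  shows "\<mu> \<cdot> pair (\<mu> \<cdot> pair f g) k = \<mu> \<cdot> pair f (\<mu> \<cdot> pair g k)"
proof -
  note [simp] = lsc_mult_typing[OF \<mu>]
  have "\<mu> \<cdot> pair (\<mu> \<cdot> pair f (g \<cdot> Id E T)) (k \<cdot> Id E T)
      = \<mu> \<cdot> pair f (\<mu> \<cdot> pair (g \<cdot> Id E T) (k \<cdot> Id E T))"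
  proof (rule lsc_natural_eqI[OF f, of "\<lambda>f h. \<mu> \<cdot> pair (\<mu> \<cdot> pair f (g \<cdot> h)) (k \<cdot> h)" \<Xi>
        "\<lambda>f h. \<mu> \<cdot> pair f (\<mu> \<cdot> pair (g \<cdot> h) (k \<cdot> h))"])
    fix S X x h assume X: "X \<in> Ob E" and x: "x \<in> hom E S X" and h: "h \<in> hom E S T"
    have gh: "g \<cdot> h \<in> hom E S \<Xi>" and kh: "k \<cdot> h \<in> hom E S \<Xi>"
      using comp_hom[OF h g] comp_hom[OF h k] .
    have "\<mu> \<cdot> pair (\<mu> \<cdot> pair (\<xi> X \<cdot> (x \<cdot> Id E S)) (g \<cdot> h)) (k \<cdot> h)
        = \<mu> \<cdot> pair (\<xi> X \<cdot> (x \<cdot> Id E S)) (\<mu> \<cdot> pair (g \<cdot> h) (k \<cdot> h))"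
    proof (rule lsc_natural_eqI2[OF gh kh, of "\<lambda>a b l. \<mu> \<cdot> pair (\<mu> \<cdot> pair (\<xi> X \<cdot> (x \<cdot> l)) a) b" \<Xi>
          "\<lambda>a b l. \<mu> \<cdot> pair (\<xi> X \<cdot> (x \<cdot> l)) (\<mu> \<cdot> pair a b)"])
      fix R Y Z y z l assume Y: "Y \<in> Ob E" and Z: "Z \<in> Ob E"
        and y: "y \<in> hom E R Y" and z: "z \<in> hom E R Z" and l: "l \<in> hom E R S"
      define w where "w = x \<cdot> l"
      have w: "w \<in> hom E R X" unfolding w_def by (rule comp_hom[OF l x])
      have wy: "pair w y \<in> hom E R (X \<otimes> Y)" and yz: "pair y z \<in> hom E R (Y \<otimes> Z)"
        using w y z by (simp_all add: hom_iff)
      let ?m = "pair (p1 X Y \<cdot> p1 (X \<otimes> Y) Z) (pair (p2 X Y \<cdot> p1 (X \<otimes> Y) Z) (p2 (X \<otimes> Y) Z))"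
      let ?r = "pair (pair (p1 X (Y \<otimes> Z)) (p1 Y Z \<cdot> p2 X (Y \<otimes> Z))) (p2 Y Z \<cdot> p2 X (Y \<otimes> Z))"
      have m: "?m \<in> hom E ((X \<otimes> Y) \<otimes> Z) (X \<otimes> (Y \<otimes> Z))" using X Y Z by (simp add: hom_iff)
      have mono: "is_mono E ?m"
        by (rule split_mono[OF m, of ?r]) (use X Y Z in \<open>simp_all add: hom_iff\<close>)
      have "\<mu> \<cdot> pair (\<mu> \<cdot> pair (\<xi> X \<cdot> w) (\<xi> Y \<cdot> y)) (\<xi> Z \<cdot> z)
          = \<xi> ((X \<otimes> Y) \<otimes> Z) \<cdot> pair (pair w y) z"
        using lsc_mult_xi[OF \<mu> w y] lsc_mult_xi[OF \<mu> wy z] by simp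
      also have "\<dots> = \<xi> (X \<otimes> (Y \<otimes> Z)) \<cdot> (?m \<cdot> pair (pair w y) z)"
        by (rule xi_mono_comp[OF m mono, symmetric]) (use w y z in \<open>simp add: hom_iff\<close>)
      also have "?m \<cdot> pair (pair w y) z = pair w (pair y z)"
        using X Y Z w y z by (simp add: hom_iff)
      also have "\<xi> (X \<otimes> (Y \<otimes> Z)) \<cdot> pair w (pair y z) = \<mu> \<cdot> pair (\<xi> X \<cdot> w) (\<mu> \<cdot> pair (\<xi> Y \<cdot> y) (\<xi> Z \<cdot> z))"
        using lsc_mult_xi[OF \<mu> y z] lsc_mult_xi[OF \<mu> w yz] by simp
      finally show "\<mu> \<cdot> pair (\<mu> \<cdot> pair (\<xi> X \<cdot> (x \<cdot> l)) (\<xi> Y \<cdot> y)) (\<xi> Z \<cdot> z)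
          = \<mu> \<cdot> pair (\<xi> X \<cdot> (x \<cdot> l)) (\<mu> \<cdot> pair (\<xi> Y \<cdot> y) (\<xi> Z \<cdot> z))"
        unfolding w_def .
    qed (use X x in \<open>simp_all add: hom_iff\<close>)
    then show "\<mu> \<cdot> pair (\<mu> \<cdot> pair (\<xi> X \<cdot> x) (g \<cdot> h)) (k \<cdot> h) = \<mu> \<cdot> pair (\<xi> X \<cdot> x) (\<mu> \<cdot> pair (g \<cdot> h) (k \<cdot> h))"
      using x by (simp add: hom_iff)
  qed (use g k in \<open>simp_all add: hom_iff\<close>)
  then show ?thesis using g k by (simp add: hom_iff)
qed

lemma lsc_mult_semilattice:
  assumes \<mu>: "lsc_mult \<mu>"
  shows "internal_meet_semilattice E \<Xi> \<mu> (\<xi> (Prod E []))"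
  unfolding internal_meet_semilattice_def
proof (intro conjI ballI)
  show "\<mu> \<in> hom E (\<Xi> \<otimes> \<Xi>) \<Xi>" using \<mu> by (simp add: lsc_mult_def)
  show "\<xi> (Prod E []) \<in> hom E (Prod E []) \<Xi>" by (simp add: hom_iff)
  fix X f g h assume X: "X \<in> Ob E" and f: "f \<in> hom E X \<Xi>" and g: "g \<in> hom E X \<Xi>" and h: "h \<in> hom E X \<Xi>"
  have m: "\<mu> \<cdot> pair a b \<in> hom E X \<Xi>" if "a \<in> hom E X \<Xi>" "b \<in> hom E X \<Xi>" for a b
    using that lsc_mult_typing[OF \<mu>] by (simp add: hom_iff)
  have t: "\<xi> (Prod E []) \<cdot> bang X \<in> hom E X \<Xi>" using X by (simp add: hom_iff)
  show "hom_meet E \<Xi> \<mu> X (hom_meet E \<Xi> \<mu> X f g) h = hom_meet E \<Xi> \<mu> X f (hom_meet E \<Xi> \<mu> X g h)"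
    using lsc_mult_assoc[OF \<mu> f g h] f g h m by (simp add: hom_meet_eq)
  show "hom_meet E \<Xi> \<mu> X f g = hom_meet E \<Xi> \<mu> X g f"
    using lsc_mult_commute[OF \<mu> f g] f g by (simp add: hom_meet_eq)
  show "hom_meet E \<Xi> \<mu> X f f = f"
    using lsc_mult_idem[OF \<mu> f] f by (simp add: hom_meet_eq)
  show "hom_meet E \<Xi> \<mu> X f (hom_top E (\<xi> (Prod E [])) X) = f"
    using lsc_mult_top[OF \<mu> f] f t by (simp add: hom_meet_eq hom_top_def)
qed

section \<open>Iterated meets and uniqueness of the order\<close>

text \<open>Precomposition preserves binary meets and the top; this moves a product of arrows inside
  the \<open>n\<close>-ary meet.\<close>

lemma foldr_hom_meet:
  assumes \<mu>: "\<mu> \<in> hom E (\<Xi> \<otimes> \<Xi>) \<Xi>" and t: "t \<in> hom E (Prod E []) \<Xi>"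
    and h: "h \<in> hom E A Q" and fs: "set fs \<subseteq> hom E Q \<Xi>"
  shows "foldr (hom_meet E \<Xi> \<mu> Q) fs (hom_top E t Q) \<in> hom E Q \<Xi> \<and>
    foldr (hom_meet E \<Xi> \<mu> Q) fs (hom_top E t Q) \<cdot> h
      = foldr (hom_meet E \<Xi> \<mu> A) (map (\<lambda>f. f \<cdot> h) fs) (hom_top E t A)"
  using fs
proof (induction fs)
  case Nil
  have "Q \<in> Ob E" "A \<in> Ob E" using h by (auto simp: hom_iff)
  then show ?case using t h by (simp add: hom_top_def hom_iff)
next
  case (Cons f fs)
  let ?r = "foldr (hom_meet E \<Xi> \<mu> Q) fs (hom_top E t Q)"
  have f: "f \<in> hom E Q \<Xi>" and r: "?r \<in> hom E Q \<Xi>" using Cons by auto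
  have rh: "foldr (hom_meet E \<Xi> \<mu> A) (map (\<lambda>f. f \<cdot> h) fs) (hom_top E t A) = ?r \<cdot> h"
    using Cons by auto
  show ?case
    using f r h \<mu> hom_meet_eq[OF f r] hom_meet_eq[OF comp_hom[OF h f] comp_hom[OF h r]]
    by (simp add: rh hom_iff)
qed

text \<open>In the inductive step, the chosen products \<open>Prod E (X # Xs)\<close> and
  \<open>X \<otimes> Prod E Xs\<close> may be different objects; the comparison map
  \<open>?m\<close> between them is monic, and this suffices to identify the two values of
  \<open>\<xi>\<close>.\<close>

lemma foldr_lsc_mult:
  assumes \<mu>: "lsc_mult \<mu>" and A: "A \<in> Ob E"
    and "list_all2 (\<lambda>X f. X \<in> Ob E \<and> f \<in> hom E A X) Xs fs"
  shows "foldr (hom_meet E \<Xi> \<mu> A) (map2 (\<lambda>X f. \<xi> X \<cdot> f) Xs fs) (hom_top E (\<xi> (Prod E [])) A)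
    = \<xi> (Prod E Xs) \<cdot> tuple E A Xs fs"
  using assms(3)
proof (induction rule: list_all2_induct)
  case Nil
  show ?case by (simp add: hom_top_def)
next
  case (Cons X Xs f fs)
  let ?P = "Prod E (X # Xs)" and ?ps = "map (\<lambda>i. proj E (X # Xs) (Suc i)) [0..<length Xs]"
  let ?t = "tuple E A Xs fs" and ?t' = "tuple E A (X # Xs) (f # fs)"
  let ?p = "tuple E ?P Xs ?ps"
  from Cons have X: "X \<in> Ob E" and f: "f \<in> hom E A X" by auto
  have Xs: "set Xs \<subseteq> Ob E" "length fs = length Xs" "\<And>i. i < length Xs \<Longrightarrow> fs ! i \<in> hom E A (Xs ! i)"
    using Cons(2) by (auto simp: list_all2_conv_all_nth in_set_conv_nth)
  have XXs: "set (X # Xs) \<subseteq> Ob E" using X Xs by simp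
  have ffs: "length (f # fs) = length (X # Xs)"
    "\<And>i. i < length (X # Xs) \<Longrightarrow> (f # fs) ! i \<in> hom E A ((X # Xs) ! i)"
    using f Xs by (auto simp: less_Suc_eq_0_disj)
  have t: "?t \<in> hom E A (Prod E Xs)" "\<And>i. i < length Xs \<Longrightarrow> proj E Xs i \<cdot> ?t = fs ! i"
    using tuple[OF Xs(1) A Xs(2,3)] by auto
  have t': "?t' \<in> hom E A ?P"
    "\<And>i. i < length (X # Xs) \<Longrightarrow> proj E (X # Xs) i \<cdot> ?t' = (f # fs) ! i"
    using tuple[OF XXs A ffs] by auto
  have P: "?P \<in> Ob E" using XXs by simp
  have projs: "proj E (X # Xs) i \<in> hom E ?P ((X # Xs) ! i)" if "i < Suc (length Xs)" for i
    using proj_hom[OF XXs] that by simp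
  have p: "?p \<in> hom E ?P (Prod E Xs)"
    "\<And>i. i < length Xs \<Longrightarrow> proj E Xs i \<cdot> ?p = proj E (X # Xs) (Suc i)"
    using tuple[OF Xs(1) P, of ?ps] projs[of "Suc i" for i] by auto
  have p_comp: "proj E Xs i \<cdot> (?p \<cdot> a) = proj E (X # Xs) (Suc i) \<cdot> a"
    if "i < length Xs" "a \<in> hom E T ?P" for i a T
    by (rule comp_eq[OF p(2)])
      (use that p(1) proj_hom[OF Xs(1) that(1)] in \<open>simp_all add: hom_iff\<close>)
  have p0: "proj E (X # Xs) 0 \<in> hom E ?P X" using projs[of 0] by simp
  let ?m = "pair (proj E (X # Xs) 0) ?p"
  have m: "?m \<in> hom E ?P (X \<otimes> Prod E Xs)" using p0 p(1) by (simp add: hom_iff)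
  have mono: "is_mono E ?m"
  proof (rule pair_mono[OF p0 p(1)])
    fix T a b assume ab: "a \<in> hom E T ?P" "b \<in> hom E T ?P"
      and eq: "proj E (X # Xs) 0 \<cdot> a = proj E (X # Xs) 0 \<cdot> b" "?p \<cdot> a = ?p \<cdot> b"
    show "a = b"
    proof (rule Prod_eqI[OF XXs ab])
      fix i assume "i < length (X # Xs)"
      then show "proj E (X # Xs) i \<cdot> a = proj E (X # Xs) i \<cdot> b"
        using eq p_comp[OF _ ab(1)] p_comp[OF _ ab(2)] by (cases i) auto
    qed
  qed
  have "?p \<cdot> ?t' = ?t"
  proof (rule Prod_eqI[OF Xs(1) comp_hom[OF t'(1) p(1)] t(1)])
    fix i assume i: "i < length Xs"
    show "proj E Xs i \<cdot> (?p \<cdot> ?t') = proj E Xs i \<cdot> ?t"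
      using p_comp[OF i t'(1)] t'(2)[of "Suc i"] t(2)[OF i] i by simp
  qed
  then have mt: "?m \<cdot> ?t' = pair f ?t"
    using t'(2)[of 0] t'(1) p0 p(1) by (simp add: hom_iff)
  have "foldr (hom_meet E \<Xi> \<mu> A) (map2 (\<lambda>X f. \<xi> X \<cdot> f) (X # Xs) (f # fs)) (hom_top E (\<xi> (Prod E [])) A)
      = hom_meet E \<Xi> \<mu> A (\<xi> X \<cdot> f) (\<xi> (Prod E Xs) \<cdot> ?t)"
    using Cons by simp
  also have "\<dots> = \<mu> \<cdot> pair (\<xi> X \<cdot> f) (\<xi> (Prod E Xs) \<cdot> ?t)"
    by (rule hom_meet_eq) (use X Xs f t(1) in \<open>simp_all add: hom_iff\<close>)
  also have "\<dots> = \<xi> (X \<otimes> Prod E Xs) \<cdot> (?m \<cdot> ?t')"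
    unfolding mt by (rule lsc_mult_xi[OF \<mu> f t(1)])
  also have "\<dots> = \<xi> ?P \<cdot> ?t'"
    by (rule xi_mono_comp[OF m mono t'(1)])
  finally show ?case .
qed

lemma prod_map:
  assumes Xs: "set Xs \<subseteq> Ob E"
  shows prod_map_hom: "prod_map E Xs (replicate (length Xs) \<Xi>) (map \<xi> Xs)
      \<in> hom E (Prod E Xs) (Prod E (replicate (length Xs) \<Xi>))"
    and proj_prod_map: "i < length Xs \<Longrightarrow>
      proj E (replicate (length Xs) \<Xi>) i \<cdot> prod_map E Xs (replicate (length Xs) \<Xi>) (map \<xi> Xs)
        = \<xi> (Xs ! i) \<cdot> proj E Xs i"
proof -
  let ?n = "length Xs" let ?\<Xi>n = "replicate ?n \<Xi>"
  have 1: "set ?\<Xi>n \<subseteq> Ob E" by auto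
  have 2: "\<xi> (Xs ! i) \<cdot> proj E Xs i \<in> hom E (Prod E Xs) \<Xi>" if "i < ?n" for i
    by (rule comp_hom[OF proj_hom[OF Xs that] xi_hom]) (use Xs nth_mem[OF that] in blast)
  note t = tuple[OF 1 Prod_Ob[OF Xs], of "map (\<lambda>i. (map \<xi> Xs ! i) \<cdot> proj E Xs i) [0..<?n]"]
  show "prod_map E Xs ?\<Xi>n (map \<xi> Xs) \<in> hom E (Prod E Xs) (Prod E ?\<Xi>n)"
    unfolding prod_map_def by (rule t(1)) (use 2 in auto)
  show "proj E ?\<Xi>n i \<cdot> prod_map E Xs ?\<Xi>n (map \<xi> Xs) = \<xi> (Xs ! i) \<cdot> proj E Xs i" if "i < ?n"
    unfolding prod_map_def by (subst t(2)) (use 2 that in auto)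
qed

text \<open>The \<open>n\<close>-ary meet after the product of the \<open>\<xi> (Xs ! i)\<close>
  becomes the fold of the arrows \<open>\<xi> (Xs ! i) \<cdot> proj E Xs i\<close>, which is
  \<open>\<xi> (Prod E Xs)\<close> at the tuple of all projections, the identity.\<close>

lemma lsc_mult_is_lsc_order:
  assumes \<mu>: "lsc_mult \<mu>"
  shows "is_lsc_order E \<Xi> \<xi> \<mu> (\<xi> (Prod E []))"
  unfolding is_lsc_order_def
proof (intro conjI allI impI)
  show "internal_meet_semilattice E \<Xi> \<mu> (\<xi> (Prod E []))" by (rule lsc_mult_semilattice[OF \<mu>])
  fix Xs assume Xs: "set Xs \<subseteq> Ob E"
  let ?n = "length Xs" let ?\<Xi>n = "replicate ?n \<Xi>"
  let ?A = "Prod E Xs" and ?Q = "Prod E ?\<Xi>n" and ?t = "\<xi> (Prod E [])"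
  let ?pm = "prod_map E Xs ?\<Xi>n (map \<xi> Xs)" and ?ps = "map (proj E Xs) [0..<?n]"
  have projs: "set (map (proj E ?\<Xi>n) [0..<?n]) \<subseteq> hom E ?Q \<Xi>"
    using proj_hom[of ?\<Xi>n] by (force simp: set_replicate_conv_if)
  have \<mu>': "\<mu> \<in> hom E (\<Xi> \<otimes> \<Xi>) \<Xi>" using \<mu> by (simp add: lsc_mult_def)
  have "nary_meet E \<Xi> \<mu> ?t ?n \<cdot> ?pm
      = foldr (hom_meet E \<Xi> \<mu> ?A) (map (\<lambda>f. f \<cdot> ?pm) (map (proj E ?\<Xi>n) [0..<?n])) (hom_top E ?t ?A)"
    unfolding nary_meet_def Let_def
    by (rule conjunct2[OF foldr_hom_meet[OF \<mu>' _ prod_map_hom[OF Xs] projs]]) (simp add: hom_iff)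
  also have "map (\<lambda>f. f \<cdot> ?pm) (map (proj E ?\<Xi>n) [0..<?n]) = map2 (\<lambda>X f. \<xi> X \<cdot> f) Xs ?ps"
    by (rule nth_equalityI) (auto simp: proj_prod_map[OF Xs])
  also have "foldr (hom_meet E \<Xi> \<mu> ?A) \<dots> (hom_top E ?t ?A) = \<xi> ?A \<cdot> tuple E ?A Xs ?ps"
    by (rule foldr_lsc_mult[OF \<mu>])
      (use Xs proj_hom[OF Xs] in \<open>auto simp: list_all2_conv_all_nth\<close>)
  also have "tuple E ?A Xs ?ps = Id E ?A"
  proof (rule Prod_eqI[OF Xs _ Id_hom])
    show "tuple E ?A Xs ?ps \<in> hom E ?A ?A"
      using tuple[OF Xs Prod_Ob[OF Xs], of ?ps] proj_hom[OF Xs] by auto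
    fix i assume "i < ?n"
    then show "proj E Xs i \<cdot> tuple E ?A Xs ?ps = proj E Xs i \<cdot> Id E ?A"
      using tuple(2)[OF Xs Prod_Ob[OF Xs], of ?ps i] proj_hom[OF Xs] by (auto simp: hom_iff)
  qed (use Xs in simp)
  finally show "nary_meet E \<Xi> \<mu> ?t ?n \<cdot> ?pm = \<xi> ?A" using Xs by simp
qed

text \<open>The empty list fixes \<open>t\<close>, and lists of length two give the defining
  property of \<open>lsc_mult\<close>.\<close>

lemma is_lsc_orderD:
  assumes "is_lsc_order E \<Xi> \<xi> \<mu> t"
  shows "lsc_mult \<mu>" "t = \<xi> (Prod E [])"
proof -
  have \<mu>: "\<mu> \<in> hom E (\<Xi> \<otimes> \<Xi>) \<Xi>" and t: "t \<in> hom E (Prod E []) \<Xi>"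
    and top: "\<And>X f. X \<in> Ob E \<Longrightarrow> f \<in> hom E X \<Xi> \<Longrightarrow> hom_meet E \<Xi> \<mu> X f (hom_top E t X) = f"
    using assms unfolding is_lsc_order_def internal_meet_semilattice_def by blast+
  have meet: "\<And>Xs. set Xs \<subseteq> Ob E \<Longrightarrow> nary_meet E \<Xi> \<mu> t (length Xs)
      \<cdot> prod_map E Xs (replicate (length Xs) \<Xi>) (map \<xi> Xs) = \<xi> (Prod E Xs)"
    using assms unfolding is_lsc_order_def by blast
  have "bang (Prod E []) = Id E (Prod E [])"
    by (rule bang_eqI[of _ "Prod E []"]) (simp_all add: hom_iff)
  then show "t = \<xi> (Prod E [])"
    using meet[of "[]"] t by (simp add: nary_meet_def hom_top_def prod_map_def hom_iff)
  have p: "p1 \<Xi> \<Xi> \<in> hom E (\<Xi> \<otimes> \<Xi>) \<Xi>" "p2 \<Xi> \<Xi> \<in> hom E (\<Xi> \<otimes> \<Xi>) \<Xi>" by (simp_all add: hom_iff)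
  \<comment> \<open>The fold meets the first projection with the meet of the second projection and
    the top; the unit law removes the top, and what remains is \<mu> after the identity.\<close>
  have nary: "nary_meet E \<Xi> \<mu> t 2 = \<mu>"
    using top[OF _ p(2)] hom_meet_eq[OF p] \<mu>
    by (simp add: nary_meet_def numeral_2_eq_2 hom_iff)
  show "lsc_mult \<mu>"
    unfolding lsc_mult_def
  proof (intro conjI ballI \<mu>)
    fix X Y assume ob: "X \<in> Ob E" "Y \<in> Ob E"
    have "prod_map E [X, Y] [\<Xi>, \<Xi>] [\<xi> X, \<xi> Y] = pair (\<xi> X \<cdot> p1 X Y) (\<xi> Y \<cdot> p2 X Y)"
      using ob by (simp add: prod_map_def pair_def)
    then show "\<mu> \<cdot> pair (\<xi> X \<cdot> p1 X Y) (\<xi> Y \<cdot> p2 X Y) = \<xi> (X \<otimes> Y)"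
      using meet[of "[X, Y]"] ob nary by (simp add: numeral_2_eq_2)
  qed
qed

text \<open>\<open>lsc_order\<close> is a definite description, so its value becomes accessible only
  through existence and uniqueness of the order.\<close>

lemma lsc_mult_lsc_order: "lsc_mult (fst (lsc_order E \<Xi> \<xi>))"
proof -
  obtain \<mu> where \<mu>: "lsc_mult \<mu>" using lsc_mult_exists by blast
  have "\<exists>!s. is_lsc_order E \<Xi> \<xi> (fst s) (snd s)"
  proof (rule ex1I[of _ "(\<mu>, \<xi> (Prod E []))"])
    show "is_lsc_order E \<Xi> \<xi> (fst (\<mu>, \<xi> (Prod E []))) (snd (\<mu>, \<xi> (Prod E [])))"
      using lsc_mult_is_lsc_order[OF \<mu>] by simp
    show "s = (\<mu>, \<xi> (Prod E []))" if "is_lsc_order E \<Xi> \<xi> (fst s) (snd s)" for s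
      using is_lsc_orderD[OF that] lsc_mult_unique[OF _ \<mu>] by (metis prod.collapse)
  qed
  from theI'[OF this] show ?thesis unfolding lsc_order_def by (rule is_lsc_orderD)
qed

end


section \<open>The quotient by an internal filter\<close>

locale lsc_filter = lsc_topos E Om tr \<Xi> \<xi>
  for E :: "('o, 'm) cat" (structure) and Om tr \<Xi> \<xi> +
  fixes F :: 'o and \<iota> :: 'm
  assumes filter: "internal_filter E \<Xi> \<xi> F \<iota>"
begin

abbreviation "\<mu> \<equiv> fst (lsc_order E \<Xi> \<xi>)"
abbreviation "fac T \<equiv> factoring E F \<iota> T"
abbreviation "Q \<equiv> filter_quotient E \<xi> F \<iota>"
abbreviation "r \<equiv> restricted_lsc E \<xi> F \<iota>"

lemmas mult_typing [simp] = lsc_mult_typing[OF lsc_mult_lsc_order]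

lemma iota: "\<iota> \<in> hom E F \<Xi>" "is_mono E \<iota>"
  using filter by (auto simp: internal_filter_def)

lemma iota_typing [simp]: "\<iota> \<in> Arr E" "Dom E \<iota> = F" "Cod E \<iota> = \<Xi>"
  using iota(1) by (auto simp: hom_iff)

lemma F_Ob [simp]: "F \<in> Ob E"
  using Dom_Ob[OF iota_typing(1)] by simp

section \<open>Arrows into \<Xi> that lie in the filter\<close>

lemma fac_iff: "f \<in> fac T \<longleftrightarrow> (\<exists>h \<in> hom E T F. \<iota> \<cdot> h = f)"
  by (auto simp: factoring_def)

lemma fac_hom: "f \<in> fac T \<Longrightarrow> f \<in> hom E T \<Xi>"
  using iota(1) by (auto simp: fac_iff intro: comp_hom)

lemma fac_comp:
  assumes "f \<in> fac T" "k \<in> hom E S T"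
  shows "f \<cdot> k \<in> fac S"
proof -
  from assms(1) obtain h where h: "h \<in> hom E T F" "\<iota> \<cdot> h = f" by (auto simp: fac_iff)
  have "f \<cdot> k = \<iota> \<cdot> (h \<cdot> k)" using h assms(2) unfolding h(2)[symmetric] by (simp add: hom_iff)
  then show ?thesis using comp_hom[OF assms(2) h(1)] by (auto simp: fac_iff)
qed

lemma fac_mult:
  assumes "f \<in> fac T" "g \<in> fac T"
  shows "\<mu> \<cdot> pair f g \<in> fac T"
proof -
  note f = fac_hom[OF assms(1)] and g = fac_hom[OF assms(2)]
  have "T \<in> Ob E" using f by (auto simp: hom_iff)
  with filter assms have "lsc_meet E \<Xi> \<xi> T f g \<in> fac T" unfolding internal_filter_def by blast
  then show ?thesis using hom_meet_eq[OF f g] by (simp add: lsc_meet_def)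
qed

lemma fac_upward:
  assumes "f \<in> fac T" "g \<in> hom E T \<Xi>" "\<mu> \<cdot> pair f g = f"
  shows "g \<in> fac T"
proof -
  note f = fac_hom[OF assms(1)]
  have "T \<in> Ob E" using f by (auto simp: hom_iff)
  moreover have "lsc_le E \<Xi> \<xi> T f g"
    using hom_meet_eq[OF f assms(2)] assms(3) by (simp add: lsc_le_def lsc_meet_def)
  ultimately show ?thesis using filter assms(1,2) unfolding internal_filter_def by blast
qed

lemma Ob_Q: "X \<in> Ob Q \<longleftrightarrow> X \<in> Ob E \<and> \<xi> X \<in> fac X"
  by (auto simp: filter_quotient_def full_subcat_def)

lemma hom_Q: "f \<in> hom Q X Y \<longleftrightarrow> f \<in> hom E X Y \<and> X \<in> Ob Q \<and> Y \<in> Ob Q"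
  by (auto simp: Ob_Q hom_def filter_quotient_def full_subcat_def)

lemma Q_sel [simp]: "Comp Q = Comp E" "Dom Q = Dom E" "Cod Q = Cod E"
  by (simp_all add: filter_quotient_def full_subcat_def)

lemma Arr_Q: "f \<in> Arr Q \<longleftrightarrow> f \<in> hom Q (Dom E f) (Cod E f)"
  by (simp add: hom_def)

lemma F_Ob_Q: "F \<in> Ob Q"
proof -
  have "\<iota> \<in> fac F"
    unfolding fac_iff by (intro bexI[of _ "Id E F"]) (simp_all add: hom_iff)
  \<comment> \<open>Since \<iota> is monic, \<open>\<xi> \<Xi> \<cdot> \<iota>\<close> is
    \<open>\<xi> F\<close>.\<close>
  moreover have "\<mu> \<cdot> pair \<iota> (\<xi> F) = \<iota>"
    using lsc_mult_increasing[OF lsc_mult_lsc_order iota(1)] xi_mono[OF iota] by simp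
  ultimately show ?thesis using fac_upward[of \<iota> F "\<xi> F"] xi_hom by (simp add: Ob_Q)
qed

lemma iota_cancel: "\<iota> \<cdot> h = \<iota> \<cdot> k \<Longrightarrow> h \<in> hom E T F \<Longrightarrow> k \<in> hom E T F \<Longrightarrow> h = k"
  using monoD[OF iota(2) _ _ _ iota(1)] .

lemma restricted_lsc:
  assumes "X \<in> Ob Q"
  shows "r X \<in> hom E X F" "\<iota> \<cdot> r X = \<xi> X"
proof -
  from assms obtain h where h: "h \<in> hom E X F" "\<iota> \<cdot> h = \<xi> X" by (auto simp: Ob_Q fac_iff)
  have "\<exists>!h. h \<in> hom E X F \<and> \<iota> \<cdot> h = \<xi> X"
  proof (rule ex1I[of _ h])
    show "k = h" if "k \<in> hom E X F \<and> \<iota> \<cdot> k = \<xi> X" for k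
      by (rule iota_cancel[of k h X]) (use h that in metis)+
  qed (use h in blast)
  from theI'[OF this] show "r X \<in> hom E X F" "\<iota> \<cdot> r X = \<xi> X"
    unfolding restricted_lsc_def by auto
qed

text \<open>The kernel pair of an arrow of the quotient lies in the quotient, being a subobject of a
  product of two objects of the quotient. So the quotient has no new monomorphisms.\<close>

lemma is_mono_Q:
  assumes m: "m \<in> hom Q X Y"
  shows "is_mono Q m \<longleftrightarrow> is_mono E m"
proof
  have mE: "m \<in> hom E X Y" and X: "X \<in> Ob Q" using m by (auto simp: hom_Q)
  then have XE: "X \<in> Ob E" and XF: "\<xi> X \<in> fac X" by (auto simp: Ob_Q)
  show "is_mono Q m" if "is_mono E m"
    using that m mE unfolding is_mono_def hom_Q Arr_Q by (auto simp: hom_iff hom_Q)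
  assume mono: "is_mono Q m"
  obtain K p q where p: "p \<in> hom E K X" and q: "q \<in> hom E K X" and pq: "m \<cdot> p = m \<cdot> q"
    and univ: "\<And>T a b. a \<in> hom E T X \<Longrightarrow> b \<in> hom E T X \<Longrightarrow> m \<cdot> a = m \<cdot> b \<Longrightarrow>
       \<exists>w \<in> hom E T K. p \<cdot> w = a \<and> q \<cdot> w = b"
    and inj: "\<And>T w w'. w \<in> hom E T K \<Longrightarrow> w' \<in> hom E T K \<Longrightarrow> p \<cdot> w = p \<cdot> w' \<Longrightarrow> q \<cdot> w = q \<cdot> w' \<Longrightarrow> w = w'"
    by (rule pullback[OF mE mE]) (rule that)
  have pq_hom: "pair p q \<in> hom E K (X \<otimes> X)" using p q by (auto simp: hom_iff)
  have pq_mono: "is_mono E (pair p q)" by (rule pair_mono[OF p q inj])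
  \<comment> \<open>The meet is \<open>\<xi> (X \<otimes> X)\<close> at \<open>pair p q\<close>,
    which is monic, so it equals \<open>\<xi> K\<close>; closure of the filter under meets then
    places \<open>K\<close> in the quotient.\<close>
  have "\<mu> \<cdot> pair (\<xi> X \<cdot> p) (\<xi> X \<cdot> q) = \<xi> K"
    using lsc_mult_xi[OF lsc_mult_lsc_order p q] xi_mono[OF pq_hom pq_mono] by simp
  then have "\<xi> K \<in> fac K"
    using fac_mult[OF fac_comp[OF XF p] fac_comp[OF XF q]] by simp
  moreover have "K \<in> Ob E" using p by (auto simp: hom_iff)
  ultimately have "p \<in> hom Q K X" "q \<in> hom Q K X" using p q X by (simp_all add: hom_Q Ob_Q)
  with mono mE pq have eq: "p = q" unfolding is_mono_def by (auto simp: hom_iff)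
  show "is_mono E m"
  proof (rule monoI[OF mE])
    fix A f g assume "f \<in> hom E A X" "g \<in> hom E A X" "m \<cdot> f = m \<cdot> g"
    from univ[OF this] eq show "f = g" by auto
  qed
qed

text \<open>Monomorphisms of the quotient are monic in \<open>E\<close>, so \<open>\<xi>\<close>
  respects them; cancelling \<iota> transfers this to \<open>r\<close>.\<close>

lemma mono_cocone_Q: "mono_cocone Q F r"
  unfolding mono_cocone_def
proof (intro conjI ballI allI impI)
  show "F \<in> Ob Q" by (rule F_Ob_Q)
  show "r X \<in> hom Q X F" if "X \<in> Ob Q" for X
    using restricted_lsc[OF that] that F_Ob_Q by (simp add: hom_Q)
  fix X Y m assume m: "m \<in> hom Q X Y" "is_mono Q m"
  then have mE: "m \<in> hom E X Y" "is_mono E m" and X: "X \<in> Ob Q" and Y: "Y \<in> Ob Q"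
    using is_mono_Q[OF m(1)] by (auto simp: hom_Q)
  note rX = restricted_lsc[OF X] and rY = restricted_lsc[OF Y]
  have "\<iota> \<cdot> (r Y \<cdot> m) = \<xi> Y \<cdot> m"
    by (rule comp_eq[OF rY(2)]) (use rY(1) mE in \<open>simp_all add: hom_iff\<close>)
  then have "\<iota> \<cdot> (r Y \<cdot> m) = \<iota> \<cdot> r X"
    using xi_mono[OF mE] rX(2) by simp
  then have "r Y \<cdot> m = r X" by (rule iota_cancel[OF _ comp_hom[OF mE(1) rY(1)] rX(1)])
  then show "r Y \<cdot>\<^bsub>Q\<^esub> m = r X" by simp
qed

section \<open>The part of an object that lies in the quotient\<close>

lemma largest_subobject:
  assumes X: "X \<in> Ob E"
  shows "\<exists>A i. i \<in> hom E A X \<and> is_mono E i \<and> A \<in> Ob Q \<and>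
    (\<forall>T. \<forall>x \<in> hom E T X. (\<exists>w \<in> hom E T A. i \<cdot> w = x) \<longleftrightarrow> \<xi> X \<cdot> x \<in> fac T)"
proof -
  obtain A i j where i: "i \<in> hom E A X" and j: "j \<in> hom E A F" and ij: "\<xi> X \<cdot> i = \<iota> \<cdot> j"
    and univ: "\<And>T a b. a \<in> hom E T X \<Longrightarrow> b \<in> hom E T F \<Longrightarrow> \<xi> X \<cdot> a = \<iota> \<cdot> b \<Longrightarrow>
       \<exists>w \<in> hom E T A. i \<cdot> w = a \<and> j \<cdot> w = b"
    and inj: "\<And>T w w'. w \<in> hom E T A \<Longrightarrow> w' \<in> hom E T A \<Longrightarrow> i \<cdot> w = i \<cdot> w' \<Longrightarrow> j \<cdot> w = j \<cdot> w' \<Longrightarrow> w = w'"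
    by (rule pullback[OF xi_hom[OF X] iota(1)]) (rule that)
  have ij_comp: "\<xi> X \<cdot> (i \<cdot> w) = \<iota> \<cdot> (j \<cdot> w)" if w: "w \<in> hom E T A" for T w
    by (rule comp_eq_comp[OF ij]) (use w i j X in \<open>simp_all add: hom_iff\<close>)
  have mono: "is_mono E i"
  proof (rule monoI[OF i])
    fix T f g assume fg: "f \<in> hom E T A" "g \<in> hom E T A" "i \<cdot> f = i \<cdot> g"
    have "\<iota> \<cdot> (j \<cdot> f) = \<iota> \<cdot> (j \<cdot> g)" using ij_comp[OF fg(1)] ij_comp[OF fg(2)] fg(3) by simp
    then have "j \<cdot> f = j \<cdot> g" by (rule iota_cancel[OF _ comp_hom[OF fg(1) j] comp_hom[OF fg(2) j]])
    with inj[OF fg] show "f = g" .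
  qed
  have "(\<exists>w \<in> hom E T A. i \<cdot> w = x) \<longleftrightarrow> \<xi> X \<cdot> x \<in> fac T" if x: "x \<in> hom E T X" for T x
  proof
    assume "\<exists>w \<in> hom E T A. i \<cdot> w = x"
    then show "\<xi> X \<cdot> x \<in> fac T" using ij_comp comp_hom[OF _ j] unfolding fac_iff by metis
  next
    assume "\<xi> X \<cdot> x \<in> fac T"
    then show "\<exists>w \<in> hom E T A. i \<cdot> w = x" using univ[OF x] unfolding fac_iff by metis
  qed
  \<comment> \<open>As \<open>i\<close> is monic, \<open>\<xi> A\<close> is
    \<open>\<xi> X \<cdot> i\<close>, and hence \<open>\<iota> \<cdot> j\<close>, a factorization
    through \<iota>.\<close>
  moreover have "A \<in> Ob Q"
    using xi_mono[OF i mono] ij j Dom_Ob[of i] i by (auto simp: Ob_Q fac_iff hom_iff)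
  ultimately show ?thesis using i mono by blast
qed

text \<open>Object and inclusion are chosen together, once for each \<open>X\<close>. For
  \<open>X\<close> in the quotient the inclusion is an isomorphism but need not be the
  identity.\<close>

definition part :: "'o \<Rightarrow> 'o \<times> 'm" where
  "part X = (SOME c. snd c \<in> hom E (fst c) X \<and> is_mono E (snd c) \<and> fst c \<in> Ob Q \<and>
    (\<forall>T. \<forall>x \<in> hom E T X. (\<exists>w \<in> hom E T (fst c). snd c \<cdot> w = x) \<longleftrightarrow> \<xi> X \<cdot> x \<in> fac T))"

abbreviation "part_ob X \<equiv> fst (part X)"
abbreviation "incl X \<equiv> snd (part X)"

lemma part:
  assumes "X \<in> Ob E"
  shows incl_hom: "incl X \<in> hom E (part_ob X) X"
    and incl_mono: "is_mono E (incl X)"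
    and part_ob: "part_ob X \<in> Ob Q"
    and incl_factor: "x \<in> hom E T X \<Longrightarrow> (\<exists>w \<in> hom E T (part_ob X). incl X \<cdot> w = x) \<longleftrightarrow> \<xi> X \<cdot> x \<in> fac T"
proof -
  have "\<exists>c. snd c \<in> hom E (fst c) X \<and> is_mono E (snd c) \<and> fst c \<in> Ob Q \<and>
    (\<forall>T. \<forall>x \<in> hom E T X. (\<exists>w \<in> hom E T (fst c). snd c \<cdot> w = x) \<longleftrightarrow> \<xi> X \<cdot> x \<in> fac T)"
    using largest_subobject[OF assms] by simp
  from someI_ex[OF this, folded part_def] show
    "incl X \<in> hom E (part_ob X) X" "is_mono E (incl X)" "part_ob X \<in> Ob Q"
    "x \<in> hom E T X \<Longrightarrow> (\<exists>w \<in> hom E T (part_ob X). incl X \<cdot> w = x) \<longleftrightarrow> \<xi> X \<cdot> x \<in> fac T"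
    by blast+
qed

section \<open>Testing subobjects over \<Xi>, and the universal property of \<open>F\<close>\<close>

lemma lsc_subobject_le:
  assumes m: "m \<in> hom E A \<Xi>" "is_mono E m" and n: "n \<in> hom E B \<Xi>" "is_mono E n"
    and eq: "\<And>X T x. X \<in> Ob E \<Longrightarrow> x \<in> hom E T X \<Longrightarrow>
       (\<exists>w \<in> hom E T A. m \<cdot> w = \<xi> X \<cdot> x) \<longleftrightarrow> (\<exists>w \<in> hom E T B. n \<cdot> w = \<xi> X \<cdot> x)"
  shows "\<exists>w \<in> hom E A B. n \<cdot> w = m"
proof (rule subobject_le[OF m n, of "Ob E" \<xi> "\<lambda>X. X"])
  fix u v assume u: "u \<in> hom E \<Xi> Om" and v: "v \<in> hom E \<Xi> Om"
    and eq: "\<And>X. X \<in> Ob E \<Longrightarrow> u \<cdot> \<xi> X = v \<cdot> \<xi> X"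
  have "u \<cdot> Id E \<Xi> = v \<cdot> Id E \<Xi>"
  proof (rule lsc_natural_eqI[of "Id E \<Xi>" \<Xi> "\<lambda>f h. u \<cdot> f" Om "\<lambda>f h. v \<cdot> f"])
    fix S X x h assume X: "X \<in> Ob E" and x: "x \<in> hom E S X"
    show "u \<cdot> (\<xi> X \<cdot> x) = v \<cdot> (\<xi> X \<cdot> x)"
      by (rule comp_eq_comp[OF eq[OF X]]) (use u v X x in \<open>simp_all add: hom_iff\<close>)
  qed (use u v in \<open>simp_all add: hom_iff\<close>)
  then show "u = v" using u v by (simp add: hom_iff)
qed (use eq xi_hom in auto)

text \<open>The case \<open>Z = L\<close> compares graphs of arrows from \<open>F\<close> to
  \<open>L\<close>; the case \<open>Z = L \<otimes> L\<close> compares pairs of values of a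
  relation.\<close>

lemma lsc_param_subobject_le:
  assumes Z: "Z \<in> Ob E"
    and m: "m \<in> hom E A (\<Xi> \<otimes> Z)" "is_mono E m" and n: "n \<in> hom E B (\<Xi> \<otimes> Z)" "is_mono E n"
    and eq: "\<And>X T x z. X \<in> Ob E \<Longrightarrow> x \<in> hom E T X \<Longrightarrow> z \<in> hom E T Z \<Longrightarrow>
       (\<exists>w \<in> hom E T A. m \<cdot> w = pair (\<xi> X \<cdot> x) z) \<longleftrightarrow> (\<exists>w \<in> hom E T B. n \<cdot> w = pair (\<xi> X \<cdot> x) z)"
  shows "\<exists>w \<in> hom E A B. n \<cdot> w = m"
proof (rule subobject_le[OF m n, of "Ob E" "\<lambda>X. pair (\<xi> X \<cdot> p1 X Z) (p2 X Z)" "\<lambda>X. X \<otimes> Z"])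
  show "u = v" if "u \<in> hom E (\<Xi> \<otimes> Z) Om" "v \<in> hom E (\<Xi> \<otimes> Z) Om"
    "\<And>X. X \<in> Ob E \<Longrightarrow> u \<cdot> pair (\<xi> X \<cdot> p1 X Z) (p2 X Z) = v \<cdot> pair (\<xi> X \<cdot> p1 X Z) (p2 X Z)" for u v
    using lsc_param_eqI[OF Z that] .
  fix X T x assume X: "X \<in> Ob E" and x: "x \<in> hom E T (X \<otimes> Z)"
  have "pair (\<xi> X \<cdot> p1 X Z) (p2 X Z) \<cdot> x = pair (\<xi> X \<cdot> (p1 X Z \<cdot> x)) (p2 X Z \<cdot> x)"
    using X Z x by (simp add: hom_iff)
  moreover have "p1 X Z \<cdot> x \<in> hom E T X" "p2 X Z \<cdot> x \<in> hom E T Z"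
    using X Z x by (simp_all add: hom_iff)
  ultimately show "(\<exists>w \<in> hom E T A. m \<cdot> w = pair (\<xi> X \<cdot> p1 X Z) (p2 X Z) \<cdot> x) \<longleftrightarrow>
      (\<exists>w \<in> hom E T B. n \<cdot> w = pair (\<xi> X \<cdot> p1 X Z) (p2 X Z) \<cdot> x)"
    using eq[OF X] by simp
qed (use Z in \<open>simp add: hom_iff\<close>)

text \<open>An arrow to \<open>F\<close> is not known to factor through some \<open>r X\<close>, but
  it does when its composite with \<iota> has the form \<open>\<xi> X \<cdot> x\<close>. This is
  enough to see that \<open>u\<close> and \<open>v\<close> have the same graph in
  \<open>\<Xi> \<otimes> L\<close>.\<close>

lemma restricted_lsc_jointly_epi:
  assumes u: "u \<in> hom E F L" and v: "v \<in> hom E F L"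
    and eq: "\<And>X. X \<in> Ob Q \<Longrightarrow> u \<cdot> r X = v \<cdot> r X"
  shows "u = v"
proof -
  have L: "L \<in> Ob E" using u by (auto simp: hom_iff)
  have graph: "pair \<iota> k \<in> hom E F (\<Xi> \<otimes> L)" "is_mono E (pair \<iota> k)" if k: "k \<in> hom E F L" for k
  proof -
    show "pair \<iota> k \<in> hom E F (\<Xi> \<otimes> L)" using k by (simp add: hom_iff)
    show "is_mono E (pair \<iota> k)"
      by (rule pair_mono[OF iota(1) k]) (rule iota_cancel)
  qed
  \<comment> \<open>The element \<open>x\<close> lies in the part of \<open>X\<close>, say as
    \<open>z\<close>; then \<open>w\<close> is \<open>r ?A \<cdot> z\<close>, as both have the same
    composite with \<iota>.\<close>
  have agree: "u \<cdot> w = v \<cdot> w" if X: "X \<in> Ob E" and x: "x \<in> hom E T X" and w: "w \<in> hom E T F"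
    and wx: "\<iota> \<cdot> w = \<xi> X \<cdot> x" for X T x w
  proof -
    let ?A = "part_ob X"
    have "\<xi> X \<cdot> x \<in> fac T" using w wx by (auto simp: fac_iff)
    with incl_factor[OF X x] obtain z where z: "z \<in> hom E T ?A" "incl X \<cdot> z = x" by blast
    note rA = restricted_lsc[OF part_ob[OF X]]
    have A: "?A \<in> Ob E" using part_ob[OF X] by (simp add: Ob_Q)
    have "\<iota> \<cdot> (r ?A \<cdot> z) = \<xi> ?A \<cdot> z"
      by (rule comp_eq[OF rA(2)]) (use rA(1) z in \<open>simp_all add: hom_iff\<close>)
    also have "\<dots> = \<iota> \<cdot> w"
      using xi_mono_comp[OF incl_hom[OF X] incl_mono[OF X] z(1)] z(2) wx by simp
    finally have w_eq: "r ?A \<cdot> z = w"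
      by (rule iota_cancel[OF _ comp_hom[OF z(1) rA(1)] w])
    have "u \<cdot> (r ?A \<cdot> z) = v \<cdot> (r ?A \<cdot> z)"
      by (rule comp_eq_comp[OF eq[OF part_ob[OF X]]]) (use u v rA(1) z(1) in \<open>simp_all add: hom_iff\<close>)
    then show ?thesis unfolding w_eq .
  qed
  have comp: "pair \<iota> k \<cdot> w = pair (\<iota> \<cdot> w) (k \<cdot> w)" if "k \<in> hom E F L" "w \<in> hom E T F" for k w T
    using that by (simp add: hom_iff)
  have "\<exists>w \<in> hom E F F. pair \<iota> v \<cdot> w = pair \<iota> u"
  proof (rule lsc_param_subobject_le[OF L graph[OF u] graph[OF v]])
    fix X T x z assume X: "X \<in> Ob E" and x: "x \<in> hom E T X" and z: "z \<in> hom E T L"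
    have fst: "\<iota> \<cdot> w = \<xi> X \<cdot> x"
      if "k \<in> hom E F L" "w \<in> hom E T F" "pair \<iota> k \<cdot> w = pair (\<xi> X \<cdot> x) z" for k w
      using pair_inject(1)[OF that(3)[unfolded comp[OF that(1,2)]] comp_hom[OF that(2) iota(1)]
          comp_hom[OF x xi_hom[OF X]] comp_hom[OF that(2,1)] z] .
    have "pair \<iota> u \<cdot> w = pair \<iota> v \<cdot> w" if "w \<in> hom E T F" "\<iota> \<cdot> w = \<xi> X \<cdot> x" for w
      using agree[OF X x that] comp[OF u that(1)] comp[OF v that(1)] by simp
    then show "(\<exists>w \<in> hom E T F. pair \<iota> u \<cdot> w = pair (\<xi> X \<cdot> x) z) \<longleftrightarrow>
        (\<exists>w \<in> hom E T F. pair \<iota> v \<cdot> w = pair (\<xi> X \<cdot> x) z)"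
      using fst[OF u] fst[OF v] by metis
  qed
  then obtain w where w: "w \<in> hom E F F" "pair \<iota> v \<cdot> w = pair \<iota> u" by blast
  note inj = pair_inject[OF w(2)[unfolded comp[OF v w(1)]] comp_hom[OF w(1) iota(1)] iota(1)
      comp_hom[OF w(1) v] u]
  \<comment> \<open>The comparison \<open>w\<close> of the two graphs commutes with their
    projections to \<Xi>, both given by \<iota>; so it is the identity, and the components in
    \<open>L\<close> agree.\<close>
  have "\<iota> \<cdot> w = \<iota> \<cdot> Id E F" using inj(1) by simp
  then have "w = Id E F" by (rule iota_cancel) (use w in \<open>simp_all add: hom_iff\<close>)
  with inj(2) v show "u = v" by (simp add: hom_iff)
qed

text \<open>A cocone \<open>\<phi>\<close> over the quotient restricts to partial maps \<open>X \<hookleftarrow> part_ob X \<rightarrow> L\<close>. Their graphs are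
  classified by maps \<open>\<gamma> X : X \<otimes> L \<rightarrow> Om\<close> compatible with monomorphisms, which glue to a relation
  \<open>\<Gamma>\<close> between \<open>\<Xi>\<close> and \<open>L\<close>. This relation is the graph of a partial map with domain \<open>F\<close>.\<close>

lemma cocone_factors:
  assumes cocone: "mono_cocone Q L \<phi>"
  shows "\<exists>u \<in> hom E F L. \<forall>X \<in> Ob Q. u \<cdot> r X = \<phi> X"
proof -
  have LQ: "L \<in> Ob Q" and \<phi>: "\<And>X. X \<in> Ob Q \<Longrightarrow> \<phi> X \<in> hom E X L"
    using cocone by (auto simp: mono_cocone_def hom_Q)
  have L: "L \<in> Ob E" using LQ by (simp add: Ob_Q)
  have \<phi>_mono: "\<phi> Y \<cdot> m = \<phi> X" if "m \<in> hom E X Y" "is_mono E m" "X \<in> Ob Q" "Y \<in> Ob Q" for X Y m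
  proof -
    have "m \<in> hom Q X Y" using that by (simp add: hom_Q)
    with cocone that(2) is_mono_Q[OF this] show ?thesis unfolding mono_cocone_def by simp
  qed
  let ?\<psi> = "\<lambda>X. \<phi> (part_ob X)"
  have \<psi>: "?\<psi> X \<in> hom E (part_ob X) L" if "X \<in> Ob E" for X
    using \<phi>[OF part_ob[OF that]] .
  \<comment> \<open>The graph as a predicate at stage \<open>T\<close>: the element \<open>x\<close>
    lies in the part of \<open>X\<close> and its value there is \<open>l\<close>.\<close>
  define gr where "gr T X x l \<longleftrightarrow> (\<exists>w \<in> hom E T (part_ob X). incl X \<cdot> w = x \<and> ?\<psi> X \<cdot> w = l)"
    for T X x l
  have gr_fac: "\<xi> X \<cdot> x \<in> fac T" if "X \<in> Ob E" "x \<in> hom E T X" "gr T X x l" for T X x l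
    using incl_factor[OF that(1,2)] that(3) unfolding gr_def by blast
  have gr_ex: "\<exists>l \<in> hom E T L. gr T X x l" if "X \<in> Ob E" "x \<in> hom E T X" "\<xi> X \<cdot> x \<in> fac T" for T X x
    using incl_factor[OF that(1,2)] that(3) comp_hom[OF _ \<psi>[OF that(1)]] unfolding gr_def by blast
  have gr_unique: "l = l'" if "X \<in> Ob E" "gr T X x l" "gr T X x l'" for T X x l l'
  proof -
    from that obtain w w' where w: "w \<in> hom E T (part_ob X)" "w' \<in> hom E T (part_ob X)"
      and eq: "incl X \<cdot> w = incl X \<cdot> w'" and l: "?\<psi> X \<cdot> w = l" "?\<psi> X \<cdot> w' = l'"
      unfolding gr_def by auto
    have "w = w'" by (rule monoD[OF incl_mono[OF that(1)] eq w incl_hom[OF that(1)]])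
    with l show ?thesis by simp
  qed
  have "\<exists>\<chi>. \<chi> \<in> hom E (X \<otimes> L) Om \<and> (\<forall>T. \<forall>x \<in> hom E T X. \<forall>l \<in> hom E T L.
      \<chi> \<cdot> pair x l = tr \<cdot> bang T \<longleftrightarrow> gr T X x l)" if X: "X \<in> Ob E" for X
  proof -
    note i = incl_hom[OF X] and p = \<psi>[OF X]
    let ?m = "pair (incl X) (?\<psi> X)"
    have m: "?m \<in> hom E (part_ob X) (X \<otimes> L)" using i p by (simp add: hom_iff)
    have mono: "is_mono E ?m"
      by (rule pair_mono[OF i p]) (rule monoD[OF incl_mono[OF X] _ _ _ i])
    obtain \<chi> where \<chi>: "\<chi> \<in> hom E (X \<otimes> L) Om"
      "\<And>T x. x \<in> hom E T (X \<otimes> L) \<Longrightarrow> \<chi> \<cdot> x = tr \<cdot> bang T \<longleftrightarrow> (\<exists>w \<in> hom E T (part_ob X). ?m \<cdot> w = x)"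
      by (rule classify[OF m mono]) (rule that)
    have "\<chi> \<cdot> pair x l = tr \<cdot> bang T \<longleftrightarrow> gr T X x l"
      if x: "x \<in> hom E T X" and l: "l \<in> hom E T L" for T x l
    proof -
      have "pair x l \<in> hom E T (X \<otimes> L)" using x l by (simp add: hom_iff)
      moreover have "?m \<cdot> w = pair x l \<longleftrightarrow> incl X \<cdot> w = x \<and> ?\<psi> X \<cdot> w = l"
        if w: "w \<in> hom E T (part_ob X)" for w
      proof -
        have "?m \<cdot> w = pair (incl X \<cdot> w) (?\<psi> X \<cdot> w)" using i p w by (simp add: hom_iff)
        then show ?thesis using pair_inject[OF _ comp_hom[OF w i] x comp_hom[OF w p] l] by auto
      qed
      ultimately show ?thesis using \<chi>(2)[of "pair x l" T] unfolding gr_def by blast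
    qed
    with \<chi>(1) show ?thesis by blast
  qed
  then obtain \<gamma> where \<gamma>: "\<And>X. X \<in> Ob E \<Longrightarrow> \<gamma> X \<in> hom E (X \<otimes> L) Om"
    and \<gamma>_gr: "\<And>X T x l. X \<in> Ob E \<Longrightarrow> x \<in> hom E T X \<Longrightarrow> l \<in> hom E T L \<Longrightarrow>
      \<gamma> X \<cdot> pair x l = tr \<cdot> bang T \<longleftrightarrow> gr T X x l"
    by metis
  \<comment> \<open>From right to left, \<open>m\<close> restricts to a monomorphism
    \<open>n\<close> between the parts, with which \<open>\<phi>\<close> is compatible. From left to
    right, \<open>\<xi> Y \<cdot> (m \<cdot> x) = \<xi> X \<cdot> x\<close> shows that
    \<open>x\<close> has a value, and single-valuedness identifies it with \<open>l\<close>.\<close>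
  have gr_mono: "gr T Y (m \<cdot> x) l \<longleftrightarrow> gr T X x l"
    if m: "m \<in> hom E X Y" "is_mono E m" and x: "x \<in> hom E T X" for X Y m T x l
  proof -
    have X: "X \<in> Ob E" and Y: "Y \<in> Ob E" using m by (auto simp: hom_iff)
    note i = incl_hom[OF X] and i' = incl_hom[OF Y]
    have fac_eq: "\<xi> Y \<cdot> (m \<cdot> y) = \<xi> X \<cdot> y" if "y \<in> hom E S X" for y S
      by (rule xi_mono_comp[OF m that])
    have "\<xi> X \<cdot> incl X \<in> fac (part_ob X)"
      using xi_mono[OF i incl_mono[OF X]] part_ob[OF X] by (simp add: Ob_Q)
    then have "\<exists>w \<in> hom E (part_ob X) (part_ob Y). incl Y \<cdot> w = m \<cdot> incl X"
      using incl_factor[OF Y comp_hom[OF i m(1)]] fac_eq[OF i] by simp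
    then obtain n where n: "n \<in> hom E (part_ob X) (part_ob Y)" "incl Y \<cdot> n = m \<cdot> incl X" by blast
    have n_comp: "incl Y \<cdot> (n \<cdot> w) = m \<cdot> (incl X \<cdot> w)" if "w \<in> hom E S (part_ob X)" for S w
      by (rule comp_eq_comp[OF n(2)]) (use that n(1) i i' m in \<open>simp_all add: hom_iff\<close>)
    have "is_mono E n"
    proof (rule monoI[OF n(1)])
      fix S f g assume f: "f \<in> hom E S (part_ob X)" and g: "g \<in> hom E S (part_ob X)" and "n \<cdot> f = n \<cdot> g"
      then have "m \<cdot> (incl X \<cdot> f) = m \<cdot> (incl X \<cdot> g)" using n_comp[OF f] n_comp[OF g] by simp
      then have "incl X \<cdot> f = incl X \<cdot> g"
        by (rule monoD[OF m(2) _ comp_hom[OF f i] comp_hom[OF g i] m(1)])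
      then show "f = g" by (rule monoD[OF incl_mono[OF X] _ f g i])
    qed
    then have \<psi>n: "?\<psi> Y \<cdot> n = ?\<psi> X" by (rule \<phi>_mono[OF n(1) _ part_ob[OF X] part_ob[OF Y]])
    have \<psi>n_comp: "?\<psi> Y \<cdot> (n \<cdot> w) = ?\<psi> X \<cdot> w" if "w \<in> hom E S (part_ob X)" for S w
      by (rule comp_eq[OF \<psi>n]) (use that n(1) \<psi>[OF Y] in \<open>simp_all add: hom_iff\<close>)
    have *: "gr T Y (m \<cdot> x) l" if g: "gr T X x l" for l
      using g n_comp \<psi>n_comp comp_hom[OF _ n(1)] unfolding gr_def by metis
    show ?thesis
    proof
      assume g: "gr T Y (m \<cdot> x) l"
      have "\<xi> X \<cdot> x \<in> fac T" using gr_fac[OF Y comp_hom[OF x m(1)] g] fac_eq[OF x] by simp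
      then obtain l' where l': "gr T X x l'" using gr_ex[OF X x] by blast
      have "l = l'" by (rule gr_unique[OF Y g *[OF l']])
      with l' show "gr T X x l" by simp
    qed (rule *)
  qed
  have "\<exists>\<Gamma>. \<Gamma> \<in> hom E (\<Xi> \<otimes> L) Om \<and> (\<forall>X \<in> Ob E. \<Gamma> \<cdot> pair (\<xi> X \<cdot> p1 X L) (p2 X L) = \<gamma> X)"
  proof (rule ex1_implies_ex[OF lsc_with_parameter[OF L Om_Ob \<gamma>]])
    fix X Y m assume m: "m \<in> hom E X Y" "is_mono E m"
    then have X: "X \<in> Ob E" and Y: "Y \<in> Ob E" by (auto simp: hom_iff)
    let ?k = "pair (m \<cdot> p1 X L) (p2 X L)"
    have k: "?k \<in> hom E (X \<otimes> L) (Y \<otimes> L)" using m(1) X L by (simp add: hom_iff)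
    show "\<gamma> Y \<cdot> ?k = \<gamma> X"
    proof (rule Om_eqI[OF comp_hom[OF k \<gamma>[OF Y]] \<gamma>[OF X]])
      fix T z assume z: "z \<in> hom E T (X \<otimes> L)"
      let ?x = "p1 X L \<cdot> z" and ?l = "p2 X L \<cdot> z"
      have x: "?x \<in> hom E T X" and l: "?l \<in> hom E T L" using X L z by (simp_all add: hom_iff)
      have "(\<gamma> Y \<cdot> ?k) \<cdot> z = \<gamma> Y \<cdot> pair (m \<cdot> ?x) ?l"
        using \<gamma>[OF Y] m(1) X L z by (simp add: hom_iff)
      moreover have "\<gamma> X \<cdot> z = \<gamma> X \<cdot> pair ?x ?l" using X L z by (simp add: hom_iff)
      ultimately show "(\<gamma> Y \<cdot> ?k) \<cdot> z = tr \<cdot> bang T \<longleftrightarrow> \<gamma> X \<cdot> z = tr \<cdot> bang T"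
        using \<gamma>_gr[OF Y comp_hom[OF x m(1)] l] \<gamma>_gr[OF X x l] gr_mono[OF m x] by simp
    qed
  qed
  then obtain \<Gamma> where \<Gamma>: "\<Gamma> \<in> hom E (\<Xi> \<otimes> L) Om"
    and \<Gamma>_xi: "\<And>X. X \<in> Ob E \<Longrightarrow> \<Gamma> \<cdot> pair (\<xi> X \<cdot> p1 X L) (p2 X L) = \<gamma> X" by blast
  obtain G g where g: "g \<in> hom E G (\<Xi> \<otimes> L)" "is_mono E g"
    and G: "\<And>T x. x \<in> hom E T (\<Xi> \<otimes> L) \<Longrightarrow> \<Gamma> \<cdot> x = tr \<cdot> bang T \<longleftrightarrow> (\<exists>w \<in> hom E T G. g \<cdot> w = x)"
    by (rule comprehension[OF \<Gamma>]) (rule that)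
  \<comment> \<open>These are the legs of the relation. What remains is that \<open>a\<close> is
    monic and that \<iota> factors through it; the mediating arrow is then \<open>b\<close>
    restricted to \<open>F\<close>.\<close>
  define a where "a = p1 \<Xi> L \<cdot> g"
  define b where "b = p2 \<Xi> L \<cdot> g"
  have a: "a \<in> hom E G \<Xi>" and b: "b \<in> hom E G L" and g_eq: "g = pair a b"
    using g(1) L by (simp_all add: a_def b_def hom_iff)
  have g_comp: "g \<cdot> w = pair (a \<cdot> w) (b \<cdot> w)" if "w \<in> hom E T G" for T w
    using a b that by (simp add: g_eq hom_iff)
  have G_inj: "w = w'"
    if "w \<in> hom E T G" "w' \<in> hom E T G" "a \<cdot> w = a \<cdot> w'" "b \<cdot> w = b \<cdot> w'" for T w w'
    by (rule monoD[OF g(2) _ that(1,2) g(1)]) (simp add: g_comp[OF that(1)] g_comp[OF that(2)] that(3,4))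
  have G_gr: "(\<exists>w \<in> hom E T G. a \<cdot> w = \<xi> X \<cdot> x \<and> b \<cdot> w = l) \<longleftrightarrow> gr T X x l"
    if X: "X \<in> Ob E" and x: "x \<in> hom E T X" and l: "l \<in> hom E T L" for X T x l
  proof -
    have xx: "\<xi> X \<cdot> x \<in> hom E T \<Xi>" by (rule comp_hom[OF x xi_hom[OF X]])
    have "\<Gamma> \<cdot> (pair (\<xi> X \<cdot> p1 X L) (p2 X L) \<cdot> pair x l) = \<gamma> X \<cdot> pair x l"
      by (rule comp_eq[OF \<Gamma>_xi[OF X]]) (use X L \<Gamma> x l in \<open>simp_all add: hom_iff\<close>)
    then have "\<Gamma> \<cdot> pair (\<xi> X \<cdot> x) l = \<gamma> X \<cdot> pair x l" using X L x l by (simp add: hom_iff)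
    moreover have "pair (\<xi> X \<cdot> x) l \<in> hom E T (\<Xi> \<otimes> L)" using xx l by (simp add: hom_iff)
    moreover have "g \<cdot> w = pair (\<xi> X \<cdot> x) l \<longleftrightarrow> a \<cdot> w = \<xi> X \<cdot> x \<and> b \<cdot> w = l" if w: "w \<in> hom E T G" for w
      using g_comp[OF w] pair_inject[OF _ comp_hom[OF w a] xx comp_hom[OF w b] l] by auto
    ultimately show ?thesis using G[of "pair (\<xi> X \<cdot> x) l" T] \<gamma>_gr[OF X x l] by auto
  qed
  \<comment> \<open>Single-valuedness is an inclusion of subobjects of
    \<open>\<Xi> \<otimes> (L \<otimes> L)\<close>: the kernel pair \<open>K\<close> of
    \<open>a\<close> consists of elements of \<Xi> with two values, and \<open>?n\<close> of those
    with one value repeated. Over each \<open>\<xi> X\<close> they coincide, because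
    \<open>gr\<close> is single-valued.\<close>
  have a_mono: "is_mono E a"
  proof -
    obtain K k1 k2 where k1: "k1 \<in> hom E K G" and k2: "k2 \<in> hom E K G" and k: "a \<cdot> k1 = a \<cdot> k2"
      and univ: "\<And>T f f'. f \<in> hom E T G \<Longrightarrow> f' \<in> hom E T G \<Longrightarrow> a \<cdot> f = a \<cdot> f' \<Longrightarrow>
         \<exists>w \<in> hom E T K. k1 \<cdot> w = f \<and> k2 \<cdot> w = f'"
      and K_inj: "\<And>T w w'. w \<in> hom E T K \<Longrightarrow> w' \<in> hom E T K \<Longrightarrow> k1 \<cdot> w = k1 \<cdot> w' \<Longrightarrow> k2 \<cdot> w = k2 \<cdot> w' \<Longrightarrow> w = w'"
      by (rule pullback[OF a a]) (rule that)
    have k_comp: "a \<cdot> (k1 \<cdot> w) = a \<cdot> (k2 \<cdot> w)" if "w \<in> hom E T K" for w T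
      by (rule comp_eq_comp[OF k]) (use that a k1 k2 in \<open>simp_all add: hom_iff\<close>)
    let ?m = "pair (a \<cdot> k1) (pair (b \<cdot> k1) (b \<cdot> k2))" and ?n = "pair a (pair b b)"
    have m: "?m \<in> hom E K (\<Xi> \<otimes> (L \<otimes> L))" and n: "?n \<in> hom E G (\<Xi> \<otimes> (L \<otimes> L))"
      using a b k1 k2 by (simp_all add: hom_iff)
    have LL: "L \<otimes> L \<in> Ob E" using L by simp
    have m_comp: "?m \<cdot> w = pair (a \<cdot> (k1 \<cdot> w)) (pair (b \<cdot> (k1 \<cdot> w)) (b \<cdot> (k2 \<cdot> w)))"
      if "w \<in> hom E T K" for w T using a b k1 k2 that by (simp add: hom_iff)
    have n_comp: "?n \<cdot> w = pair (a \<cdot> w) (pair (b \<cdot> w) (b \<cdot> w))"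
      if "w \<in> hom E T G" for w T using a b that by (simp add: hom_iff)
    have triple: "f = f' \<and> l1 = l1' \<and> l2 = l2'"
      if "pair f (pair l1 l2) = pair f' (pair l1' l2')" "f \<in> hom E T \<Xi>" "f' \<in> hom E T \<Xi>"
        "l1 \<in> hom E T L" "l1' \<in> hom E T L" "l2 \<in> hom E T L" "l2' \<in> hom E T L" for f f' l1 l1' l2 l2' T
    proof -
      have h: "pair l1 l2 \<in> hom E T (L \<otimes> L)" "pair l1' l2' \<in> hom E T (L \<otimes> L)"
        using that(4-7) by (simp_all add: hom_iff)
      note i = pair_inject[OF that(1,2,3) h]
      from i(1) pair_inject[OF i(2) that(4-7)] show ?thesis by blast
    qed
    have m_mono: "is_mono E ?m"
    proof (rule monoI[OF m])
      fix T w w' assume w: "w \<in> hom E T K" and w': "w' \<in> hom E T K" and "?m \<cdot> w = ?m \<cdot> w'"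
      then have eq: "pair (a \<cdot> (k1 \<cdot> w)) (pair (b \<cdot> (k1 \<cdot> w)) (b \<cdot> (k2 \<cdot> w)))
          = pair (a \<cdot> (k1 \<cdot> w')) (pair (b \<cdot> (k1 \<cdot> w')) (b \<cdot> (k2 \<cdot> w')))"
        using m_comp[OF w] m_comp[OF w'] by simp
      note h = comp_hom[OF w k1] comp_hom[OF w' k1] comp_hom[OF w k2] comp_hom[OF w' k2]
      from triple[OF eq comp_hom[OF h(1) a] comp_hom[OF h(2) a] comp_hom[OF h(1) b] comp_hom[OF h(2) b]
          comp_hom[OF h(3) b] comp_hom[OF h(4) b]]
      have e: "a \<cdot> (k1 \<cdot> w) = a \<cdot> (k1 \<cdot> w')" "b \<cdot> (k1 \<cdot> w) = b \<cdot> (k1 \<cdot> w')" "b \<cdot> (k2 \<cdot> w) = b \<cdot> (k2 \<cdot> w')"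
        by blast+
      then have "a \<cdot> (k2 \<cdot> w) = a \<cdot> (k2 \<cdot> w')" using k_comp[OF w] k_comp[OF w'] by simp
      from G_inj[OF h(1,2) e(1,2)] G_inj[OF h(3,4) this e(3)] show "w = w'"
        by (rule K_inj[OF w w'])
    qed
    have n_mono: "is_mono E ?n"
    proof (rule monoI[OF n])
      fix T w w' assume w: "w \<in> hom E T G" and w': "w' \<in> hom E T G" and "?n \<cdot> w = ?n \<cdot> w'"
      then have eq: "pair (a \<cdot> w) (pair (b \<cdot> w) (b \<cdot> w)) = pair (a \<cdot> w') (pair (b \<cdot> w') (b \<cdot> w'))"
        using n_comp[OF w] n_comp[OF w'] by simp
      from triple[OF eq comp_hom[OF w a] comp_hom[OF w' a] comp_hom[OF w b] comp_hom[OF w' b]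
          comp_hom[OF w b] comp_hom[OF w' b]]
      show "w = w'" using G_inj[OF w w'] by blast
    qed
    have "\<exists>w \<in> hom E K G. ?n \<cdot> w = ?m"
    proof (rule lsc_param_subobject_le[OF LL m m_mono n n_mono])
      fix X T x z assume X: "X \<in> Ob E" and x: "x \<in> hom E T X" and z: "z \<in> hom E T (L \<otimes> L)"
      let ?l = "p1 L L \<cdot> z" and ?l' = "p2 L L \<cdot> z"
      have l: "?l \<in> hom E T L" "?l' \<in> hom E T L" and z_eq: "z = pair ?l ?l'"
        using z L by (simp_all add: hom_iff)
      note xx = comp_hom[OF x xi_hom[OF X]]
      show "(\<exists>w \<in> hom E T K. ?m \<cdot> w = pair (\<xi> X \<cdot> x) z) \<longleftrightarrow> (\<exists>w \<in> hom E T G. ?n \<cdot> w = pair (\<xi> X \<cdot> x) z)"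
      proof
        assume "\<exists>w \<in> hom E T K. ?m \<cdot> w = pair (\<xi> X \<cdot> x) z"
        then obtain w where w: "w \<in> hom E T K" "?m \<cdot> w = pair (\<xi> X \<cdot> x) z" by blast
        note h = comp_hom[OF w(1) k1] comp_hom[OF w(1) k2]
        have "pair (a \<cdot> (k1 \<cdot> w)) (pair (b \<cdot> (k1 \<cdot> w)) (b \<cdot> (k2 \<cdot> w))) = pair (\<xi> X \<cdot> x) (pair ?l ?l')"
          using m_comp[OF w(1)] w(2) z_eq by metis
        from triple[OF this comp_hom[OF h(1) a] xx comp_hom[OF h(1) b] l(1) comp_hom[OF h(2) b] l(2)]
        have e: "a \<cdot> (k1 \<cdot> w) = \<xi> X \<cdot> x" "b \<cdot> (k1 \<cdot> w) = ?l" "b \<cdot> (k2 \<cdot> w) = ?l'" by blast+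
        have e': "a \<cdot> (k2 \<cdot> w) = \<xi> X \<cdot> x" using k_comp[OF w(1)] e(1) by metis
        have "gr T X x ?l" "gr T X x ?l'"
          using G_gr[OF X x l(1)] G_gr[OF X x l(2)] h e e' by blast+
        then have "?l = ?l'" by (rule gr_unique[OF X])
        then have "?n \<cdot> (k1 \<cdot> w) = pair (\<xi> X \<cdot> x) z"
          using n_comp[OF h(1)] e z_eq by metis
        with h(1) show "\<exists>w \<in> hom E T G. ?n \<cdot> w = pair (\<xi> X \<cdot> x) z" by blast
      next
        assume "\<exists>w \<in> hom E T G. ?n \<cdot> w = pair (\<xi> X \<cdot> x) z"
        then obtain w where w: "w \<in> hom E T G" "?n \<cdot> w = pair (\<xi> X \<cdot> x) z" by blast
        from univ[OF w(1) w(1) refl] obtain d where d: "d \<in> hom E T K" "k1 \<cdot> d = w" "k2 \<cdot> d = w" by blast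
        have "?m \<cdot> d = pair (\<xi> X \<cdot> x) z"
          using m_comp[OF d(1)] n_comp[OF w(1)] w(2) d(2,3) by simp
        with d(1) show "\<exists>w \<in> hom E T K. ?m \<cdot> w = pair (\<xi> X \<cdot> x) z" by blast
      qed
    qed
    then obtain w where w: "w \<in> hom E K G" "?n \<cdot> w = ?m" by blast
    from triple[OF w(2)[unfolded n_comp[OF w(1)]] comp_hom[OF w(1) a] comp_hom[OF k1 a]
        comp_hom[OF w(1) b] comp_hom[OF k1 b] comp_hom[OF w(1) b] comp_hom[OF k2 b]]
    \<comment> \<open>The last two coordinates of \<open>?n \<cdot> w\<close> coincide, hence so do
      those of \<open>?m\<close>.\<close>
    have "b \<cdot> k1 = b \<cdot> k2" by metis
    with k have k12: "k1 = k2" by (rule G_inj[OF k1 k2])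
    show ?thesis
    proof (rule monoI[OF a])
      fix T f f' assume "f \<in> hom E T G" "f' \<in> hom E T G" "a \<cdot> f = a \<cdot> f'"
      from univ[OF this] k12 show "f = f'" by auto
    qed
  qed
  \<comment> \<open>Over \<open>\<xi> X\<close>, an element \<open>x\<close> has a value exactly
    when \<open>\<xi> X \<cdot> x\<close> lies in the filter, so \<iota> and \<open>a\<close>
    restrict to the same subobject of each \<open>X\<close>.\<close>
  have "\<exists>w \<in> hom E F G. a \<cdot> w = \<iota>"
  proof (rule lsc_subobject_le[OF iota a a_mono])
    fix X T x assume X: "X \<in> Ob E" and x: "x \<in> hom E T X"
    show "(\<exists>w \<in> hom E T F. \<iota> \<cdot> w = \<xi> X \<cdot> x) \<longleftrightarrow> (\<exists>w \<in> hom E T G. a \<cdot> w = \<xi> X \<cdot> x)"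
    proof
      assume "\<exists>w \<in> hom E T F. \<iota> \<cdot> w = \<xi> X \<cdot> x"
      then obtain l where "l \<in> hom E T L" "gr T X x l" using gr_ex[OF X x] unfolding fac_iff by blast
      then show "\<exists>w \<in> hom E T G. a \<cdot> w = \<xi> X \<cdot> x" using G_gr[OF X x] by blast
    next
      assume "\<exists>w \<in> hom E T G. a \<cdot> w = \<xi> X \<cdot> x"
      then obtain w where w: "w \<in> hom E T G" "a \<cdot> w = \<xi> X \<cdot> x" by blast
      then have "gr T X x (b \<cdot> w)" using G_gr[OF X x comp_hom[OF w(1) b]] by blast
      then show "\<exists>w \<in> hom E T F. \<iota> \<cdot> w = \<xi> X \<cdot> x" using gr_fac[OF X x] unfolding fac_iff by blast
    qed
  qed
  then obtain v where v: "v \<in> hom E F G" "a \<cdot> v = \<iota>" by blast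
  have "(b \<cdot> v) \<cdot> r X = \<phi> X" if X: "X \<in> Ob Q" for X
  proof -
    have XE: "X \<in> Ob E" using X by (simp add: Ob_Q)
    note rX = restricted_lsc[OF X] and id = Id_hom[OF XE]
    note vr = comp_hom[OF rX(1) v(1)]
    have "a \<cdot> (v \<cdot> r X) = \<iota> \<cdot> r X"
      by (rule comp_eq[OF v(2)]) (use a v(1) rX(1) in \<open>simp_all add: hom_iff\<close>)
    then have "a \<cdot> (v \<cdot> r X) = \<xi> X \<cdot> Id E X" using rX(2) XE by simp
    then have "gr X X (Id E X) (b \<cdot> (v \<cdot> r X))" using G_gr[OF XE id comp_hom[OF vr b]] vr by blast
    \<comment> \<open>At the identity element, \<open>gr\<close> yields a section \<open>w\<close>
      of \<open>incl X\<close>. A section is monic, so the cocone property identifies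
      \<open>?\<psi> X \<cdot> w\<close> with \<open>\<phi> X\<close>.\<close>
    then obtain w where w: "w \<in> hom E X (part_ob X)" "incl X \<cdot> w = Id E X"
      and eq: "?\<psi> X \<cdot> w = b \<cdot> (v \<cdot> r X)" unfolding gr_def by blast
    have "is_mono E w" by (rule split_mono[OF w(1) incl_hom[OF XE] w(2)])
    then have "?\<psi> X \<cdot> w = \<phi> X" by (rule \<phi>_mono[OF w(1) _ X part_ob[OF XE]])
    then show ?thesis using eq b v(1) rX(1) by (simp add: hom_iff)
  qed
  with comp_hom[OF v(1) b] show ?thesis by blast
qed

lemma local_state_classifier_quotient: "local_state_classifier Q F r"
  unfolding local_state_classifier_def
proof (intro conjI allI impI)
  show "mono_cocone Q F r" by (rule mono_cocone_Q)
  fix L \<phi> assume cocone: "mono_cocone Q L \<phi>"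
  then have L: "L \<in> Ob Q" by (simp add: mono_cocone_def)
  from cocone_factors[OF cocone] obtain u where u: "u \<in> hom E F L" "\<And>X. X \<in> Ob Q \<Longrightarrow> u \<cdot> r X = \<phi> X"
    by blast
  show "\<exists>!u. u \<in> hom Q F L \<and> (\<forall>X \<in> Ob Q. u \<cdot>\<^bsub>Q\<^esub> r X = \<phi> X)"
  proof (rule ex1I[of _ u])
    show "u \<in> hom Q F L \<and> (\<forall>X \<in> Ob Q. u \<cdot>\<^bsub>Q\<^esub> r X = \<phi> X)"
      using u L F_Ob_Q by (simp add: hom_Q)
    show "v = u" if "v \<in> hom Q F L \<and> (\<forall>X \<in> Ob Q. v \<cdot>\<^bsub>Q\<^esub> r X = \<phi> X)" for v
      by (rule restricted_lsc_jointly_epi[OF _ u(1)]) (use that u(2) in \<open>simp_all add: hom_Q\<close>)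
  qed
qed

end

theorem theorem3p1:
  fixes E :: "('o, 'm) cat" and \<Xi> F :: 'o and \<xi> :: "'o \<Rightarrow> 'm" and \<iota>\<^sub>F :: 'm
  assumes "elementary_topos E"
    and "local_state_classifier E \<Xi> \<xi>"
    and "internal_filter E \<Xi> \<xi> F \<iota>\<^sub>F"
  shows "local_state_classifier (filter_quotient E \<xi> F \<iota>\<^sub>F) F (restricted_lsc E \<xi> F \<iota>\<^sub>F)"
proof -
  from assms(1) obtain Om tr where "is_subobject_classifier E Om tr"
    unfolding elementary_topos_def by blast
  with assms interpret lsc_filter E Om tr \<Xi> \<xi> F "\<iota>\<^sub>F"
    by unfold_locales (auto simp: elementary_topos_def)
  show ?thesis by (rule local_state_classifier_quotient)
qed

end
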